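(* Let $f(z)=z^2+c$ with $c\in\mathbb{C}$, and let $z_0\in\mathbb{C}$ be a Cremer periodic point of $f$ of minimal period $p$. Then for every $\delta>0$ there exists $r_0>0$ such that for every positive integer $n$, setting $r_n=r_0\exp(-n\delta)$, there are at most $p$ periodic orbits of $f$ of minimal period $np$ that are entirely contained in the union of open discs $\bigcup_{i=0}^{p-1}B(f^i(z_0),r_n)$.
   Context: A periodic point $z_0$ of minimal period $p$ is Cremer if $(f^p)'(z_0)=e^{2\pi i\alpha}$ with $\alpha$ irrational (so $|(f^p)'(z_0)|=1$ and it is not a root of unity) and $f^p$ is not holomorphically linearizable in any neighbourhood of $z_0$. $B(w,r)$ denotes the open Euclidean disc of radius $r$ centred at $w$. *)

theory Defs
  imports "HOL-Analysis.Analysis"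
begin

definition minimal_period :: "(complex \<Rightarrow> complex) \<Rightarrow> nat \<Rightarrow> complex \<Rightarrow> bool" where
  "minimal_period f p z \<longleftrightarrow> p > 0 \<and> (f ^^ p) z = z \<and> (\<forall>k. 0 < k \<and> k < p \<longrightarrow> (f ^^ k) z \<noteq> z)"

definition holo_linearizable :: "(complex \<Rightarrow> complex) \<Rightarrow> complex \<Rightarrow> complex \<Rightarrow> bool" where
  "holo_linearizable g z0 lam \<longleftrightarrow>
     (\<exists>U phi. open U \<and> z0 \<in> U \<and> phi holomorphic_on U \<and> inj_on phi U \<and> phi z0 = 0 \<and>
        (\<forall>z\<in>U. g z \<in> U \<longrightarrow> phi (g z) = lam * phi z))"

definition cremer_point :: "(complex \<Rightarrow> complex) \<Rightarrow> nat \<Rightarrow> complex \<Rightarrow> bool" where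
  "cremer_point f p z0 \<longleftrightarrow> minimal_period f p z0 \<and>
     (\<exists>\<alpha>::real. \<alpha> \<notin> \<rat> \<and> deriv (f ^^ p) z0 = exp (2 * of_real pi * \<i> * of_real \<alpha>)) \<and>
     \<not> holo_linearizable (f ^^ p) z0 (deriv (f ^^ p) z0)"

definition periodic_orbits :: "(complex \<Rightarrow> complex) \<Rightarrow> nat \<Rightarrow> complex set set" where
  "periodic_orbits f m = {{(f ^^ k) w | k. k < m} | w. minimal_period f m w}"

end

theory Submission
  imports Defs "HOL-Complex_Analysis.Conformal_Mappings" "HOL-Real_Asymp.Real_Asymp"
begin

text \<open>
  In fact at most one orbit of period \<open>np\<close> fits into the discs. Suppose that there were two,
  and put \<open>F(z) = f^(np)(z) - z\<close>. Near each point of the cycle, \<open>F\<close> has \<open>2n + 1\<close> zeros within distance \<open>r = r_n\<close>,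
  while \<open>F\<close> is bounded on a disc of radius about \<open>1/n\<close>. By the maximum principle \<open>F\<close> is of size \<open>(C n r)^(2n+1)\<close>
  at distance comparable to \<open>r\<close>: there \<open>f\<close> is almost periodic, and both the multiplier of each orbit and
  \<open>\<lambda>^n\<close> (with \<open>\<lambda>\<close> the multiplier of the cycle) are extremely close to \<open>1\<close>.

  Let \<open>(f_* \<phi>)(z)\<close> be the sum of \<open>\<phi>(w) / f'(w)^2\<close> over the two preimages \<open>w\<close> of \<open>z\<close>, which contracts the area integral
  of \<open>\<bar>\<phi>\<bar>\<close>. It sends \<open>1 / (z - y)\<close> to a multiple of \<open>1 / (z - f(y)) - 1 / (z - c)\<close>. So a suitable
  combination \<open>\<phi>\<close> of simple poles at the \<open>(n + 1)p\<close> points of the first orbit and of the cycle has no pole of \<open>f_* \<phi>\<close> at the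
  critical value \<open>c\<close>, and satisfies \<open>f_* \<phi> = \<kappa> \<phi> + error\<close> with \<open>\<bar>\<kappa>\<bar> = 1\<close>. Integrating \<open>\<bar>\<phi>\<bar>\<close> over a large disc with the
  poles cut off at distance about \<open>r\<close> loses a definite amount of mass near the boundary. What can be gained near the cut-off
  is at most \<open>r^(-n-1)\<close> (the order of growth of \<open>\<phi>\<close>) times \<open>(C n r)^(2n+1) / r\<close> (the drift of the cut-off
  under \<open>f\<close>). This contradicts the loss once \<open>n^8 r\<close> is small, which \<open>r = r0 exp(-n \<delta>)\<close> guarantees.
\<close>

section \<open>Area integrals and the squaring map\<close>

text \<open>Change of variables is available on \<open>real^'n\<close>, so area integrals over sets
  of complex numbers are pulled back along this isometry.\<close>

definition of_plane :: "real^2 \<Rightarrow> complex" where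
  "of_plane x = Complex (x $ 1) (x $ 2)"

definition plane_int :: "complex set \<Rightarrow> (complex \<Rightarrow> real) \<Rightarrow> real" where
  "plane_int S F = integral (of_plane -` S) (\<lambda>x. F (of_plane x))"

lemma norm_of_plane: "norm (of_plane x) = norm x"
  by (simp add: of_plane_def norm_vec_def L2_set_def cmod_def UNIV_2)

lemma continuous_of_plane [continuous_intros]:
  "continuous_on S g \<Longrightarrow> continuous_on S (\<lambda>x. of_plane (g x))"
  unfolding of_plane_def by (auto simp: Complex_eq intro!: continuous_intros)

lemma compact_vimage_of_plane:
  assumes "compact S" shows "compact (of_plane -` S)"
proof -
  have "closed (of_plane -` S)"
    using assms continuous_of_plane[OF continuous_on_id, of UNIV]
    by (auto intro!: continuous_closed_vimage simp: continuous_on_eq_continuous_at compact_imp_closed)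
  moreover have "bounded (of_plane -` S)"
    using compact_imp_bounded[OF assms] unfolding bounded_iff by (metis norm_of_plane vimageD)
  ultimately show ?thesis by (simp add: compact_eq_bounded_closed)
qed

lemma absolutely_integrable_compact:
  fixes F :: "'a::euclidean_space \<Rightarrow> real"
  assumes "compact S" "continuous_on S F"
  shows "F absolutely_integrable_on S"
proof -
  have 1: "integrable lborel (\<lambda>x. indicator S x *\<^sub>R F x)"
    using borel_integrable_compact assms by blast
  then have "integrable lebesgue (\<lambda>x. indicator S x *\<^sub>R F x)"
    by (subst integrable_completion) (auto simp: borel_measurable_integrable)
  then show ?thesis by (simp add: set_integrable_def)
qed

lemma plane_integrable:
  fixes F :: "complex \<Rightarrow> real"
  assumes "compact S" "continuous_on S F"
  shows "(\<lambda>x. F (of_plane x)) absolutely_integrable_on (of_plane -` S)"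
proof -
  have "continuous_on (of_plane -` S) (\<lambda>x. F (of_plane x))"
    using continuous_on_compose2[OF assms(2) continuous_of_plane[OF continuous_on_id]] by auto
  then show ?thesis
    using absolutely_integrable_compact[OF compact_vimage_of_plane[OF assms(1)]] by blast
qed

lemma plane_int_mono:
  assumes "compact S" "continuous_on S F" "continuous_on S G" "\<And>z. z \<in> S \<Longrightarrow> F z \<le> G z"
  shows "plane_int S F \<le> plane_int S G"
  unfolding plane_int_def
  using assms plane_integrable[of S F] plane_integrable[of S G]
  by (intro integral_le) (auto simp: absolutely_integrable_on_def)

lemma plane_int_diff:
  assumes "compact S" "continuous_on S F" "continuous_on S G"
  shows "plane_int S (\<lambda>z. F z - G z) = plane_int S F - plane_int S G"
  unfolding plane_int_def
  using assms plane_integrable[of S F] plane_integrable[of S G]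
  by (intro integral_diff) (auto simp: absolutely_integrable_on_def)

lemma absolutely_integrable_subset_lebesgue:
  fixes F :: "real^2 \<Rightarrow> real"
  assumes "F absolutely_integrable_on S" "T \<in> sets lebesgue" "T \<subseteq> S"
  shows "F absolutely_integrable_on T"
  using set_integrable_subset assms by blast

section \<open>The change of variables under squaring\<close>

definition plane_sq :: "complex \<Rightarrow> real^2 \<Rightarrow> real^2" where
  "plane_sq c x = (\<chi> i. if i = 1 then (x$1)\<^sup>2 - (x$2)\<^sup>2 + Re c else 2 * x$1 * x$2 + Im c)"

lemma of_plane_sq: "of_plane (plane_sq c x) = (of_plane x)\<^sup>2 + c"
  by (simp add: of_plane_def plane_sq_def complex_eq_iff power2_eq_square)

lemma has_derivative_plane_sq:
  "(plane_sq c has_derivative (\<lambda>h. \<chi> i. if i = 1 then 2 * x$1 * h$1 - 2 * x$2 * h$2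
       else 2 * x$1 * h$2 + 2 * x$2 * h$1)) (at x within S)"
proof -
  have *: "((\<lambda>x. if i = 1 then (x$1)\<^sup>2 - (x$2)\<^sup>2 + Re c else 2 * x$1 * x$2 + Im c) has_derivative
      (\<lambda>h. if i = 1 then 2 * x$1 * h$1 - 2 * x$2 * h$2 else 2 * x$1 * h$2 + 2 * x$2 * h$1)) (at x within S)" for i :: 2
    by (cases "i = 1") (auto intro!: derivative_eq_intros bounded_linear_imp_has_derivative simp: algebra_simps)
  show ?thesis unfolding plane_sq_def
  proof (subst has_derivative_componentwise_within, rule ballI)
    fix b :: "real^2" assume "b \<in> Basis"
    then obtain i where b: "b = axis i 1" by (auto simp: Basis_vec_def)
    show "((\<lambda>x. (\<chi> i. if i = 1 then (x$1)\<^sup>2 - (x$2)\<^sup>2 + Re c else 2 * x$1 * x$2 + Im c) \<bullet> b) has_derivative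
       (\<lambda>h. (\<chi> i. if i = 1 then 2 * x$1 * h$1 - 2 * x$2 * h$2 else 2 * x$1 * h$2 + 2 * x$2 * h$1) \<bullet> b)) (at x within S)"
      unfolding b by (simp only: inner_axis' inner_axis inner_real_def mult_1_right vec_lambda_beta) (rule *)
  qed
qed

text \<open>The real Jacobian of a holomorphic map is the squared modulus of its derivative, here of
  \<open>2 * w\<close>.\<close>

lemma det_plane_sq:
  "det (matrix (\<lambda>h::real^2. (\<chi> i. if i = 1 then 2 * x$1 * h$1 - 2 * x$2 * h$2
       else 2 * x$1 * h$2 + 2 * x$2 * h$1)::real^2)) = 4 * (norm (of_plane x))\<^sup>2"
proof -
  have "(norm x)\<^sup>2 = (x$1)\<^sup>2 + (x$2)\<^sup>2"
    unfolding power2_norm_eq_inner inner_vec_def UNIV_2 by (simp add: power2_eq_square)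
  then show ?thesis
    unfolding norm_of_plane by (simp add: det_2 matrix_def axis_def power2_eq_square algebra_simps)
qed

text \<open>The change of variables theorem speaks of functions into some \<open>real^'n\<close>; a
  real function passes through it as one with values in \<open>real^1\<close>.\<close>

lemma change_of_variables_real_valued:
  fixes u :: "real^'m::{finite,wellorder} \<Rightarrow> real" and g :: "real^'m::_ \<Rightarrow> real^'m::_"
  assumes "S \<in> sets lebesgue"
    and "\<And>x. x \<in> S \<Longrightarrow> (g has_derivative g' x) (at x within S)"
    and "inj_on g S" and "u absolutely_integrable_on (g ` S)"
  shows "(\<lambda>x. \<bar>det (matrix (g' x))\<bar> * u (g x)) absolutely_integrable_on S"
    and "integral S (\<lambda>x. \<bar>det (matrix (g' x))\<bar> * u (g x)) = integral (g ` S) u"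
proof -
  have "(\<lambda>x. vec (u x) :: real^1) absolutely_integrable_on (g ` S)"
    using assms(4) by (simp add: absolutely_integrable_on_1_iff)
  moreover have "integral (g ` S) (\<lambda>x. vec (u x) :: real^1) = vec (integral (g ` S) u)"
    by (simp add: integral_on_1_eq)
  ultimately have *: "(\<lambda>x. \<bar>det (matrix (g' x))\<bar> *\<^sub>R (vec (u (g x)) :: real^1)) absolutely_integrable_on S \<and>
      integral S (\<lambda>x. \<bar>det (matrix (g' x))\<bar> *\<^sub>R (vec (u (g x)) :: real^1)) = vec (integral (g ` S) u)"
    using has_absolute_integral_change_of_variables[OF assms(1-3), of "\<lambda>x. vec (u x) :: real^1" "vec (integral (g ` S) u)"]
    by blast
  then show "(\<lambda>x. \<bar>det (matrix (g' x))\<bar> * u (g x)) absolutely_integrable_on S"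
    by (simp add: absolutely_integrable_on_1_iff)
  from * have "vec (integral S (\<lambda>x. \<bar>det (matrix (g' x))\<bar> * u (g x))) = (vec (integral (g ` S) u) :: real^1)"
    by (simp add: integral_on_1_eq)
  then show "integral S (\<lambda>x. \<bar>det (matrix (g' x))\<bar> * u (g x)) = integral (g ` S) u"
    by (simp add: vec_eq_iff)
qed

lemma integral_reflect_plane:
  fixes v :: "real^2 \<Rightarrow> real"
  assumes "S \<in> sets lebesgue" "v absolutely_integrable_on (uminus ` S)"
  shows "(\<lambda>x. v (- x)) absolutely_integrable_on S"
    and "integral S (\<lambda>x. v (- x)) = integral (uminus ` S) v"
proof -
  have d: "(uminus has_derivative uminus) (at x within S)" for x :: "real^2"
    by (auto intro!: derivative_eq_intros)
  have "det (matrix (uminus :: real^2 \<Rightarrow> real^2)) = 1"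
    by (simp add: det_2 matrix_def axis_def)
  then show "(\<lambda>x. v (- x)) absolutely_integrable_on S"
    and "integral S (\<lambda>x. v (- x)) = integral (uminus ` S) v"
    using change_of_variables_real_valued[OF assms(1) d _ assms(2)] by (simp_all add: inj_on_def)
qed

lemma inj_on_plane_sq: "inj_on (plane_sq c) {x. x $ 1 > 0}"
proof (rule inj_onI)
  fix x y :: "real^2" assume x: "x \<in> {x. x $ 1 > 0}" and y: "y \<in> {x. x $ 1 > 0}" and e: "plane_sq c x = plane_sq c y"
  have "(of_plane x)\<^sup>2 = (of_plane y)\<^sup>2"
    using e of_plane_sq[of c x] of_plane_sq[of c y] by simp
  then have "of_plane x = of_plane y \<or> of_plane x = - of_plane y" by (simp add: power2_eq_iff)
  with x y show "x = y"
    by (auto simp: of_plane_def vec_eq_iff forall_2 complex_eq_iff)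
qed

text \<open>The contraction property of the push-forward. On the right half-plane squaring is
  injective with Jacobian \<open>4 * (norm w)\<^sup>2\<close>, so the left-hand integral becomes one
  over half of the preimage of \<open>D\<close>. There the integrand is at most
  \<open>v w + v (- w)\<close>, and reflection in the origin turns the second term into the integral
  of \<open>v\<close> over the other half.\<close>

lemma plane_int_square_transfer:
  fixes u v :: "complex \<Rightarrow> real" and c :: complex
  assumes D: "compact D" and u: "continuous_on D u"
    and D': "compact {w. w\<^sup>2 + c \<in> D}" and v: "continuous_on {w. w\<^sup>2 + c \<in> D} v"
    and le: "\<And>w. w \<noteq> 0 \<Longrightarrow> w\<^sup>2 + c \<in> D \<Longrightarrow> 4 * (norm w)\<^sup>2 * u (w\<^sup>2 + c) \<le> v w + v (- w)"
  shows "plane_int D u \<le> plane_int {w. w\<^sup>2 + c \<in> D} v"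
proof -
  define D' where "D' = {w. w\<^sup>2 + c \<in> D}"
  define S where "S = of_plane -` D' \<inter> {x. x $ 1 > 0}"
  define S2 where "S2 = of_plane -` D' \<inter> {x. x $ 1 < 0}"
  have uD: "(\<lambda>x. u (of_plane x)) absolutely_integrable_on (of_plane -` D)"
    using plane_integrable D u by blast
  have vD: "(\<lambda>x. v (of_plane x)) absolutely_integrable_on (of_plane -` D')"
    using plane_integrable D' v unfolding D'_def by blast
  have cl: "closed (of_plane -` D')"
    using compact_vimage_of_plane D' unfolding D'_def by (blast intro: compact_imp_closed)
  have "open {x::real^2. x $ 1 > 0}" "open {x::real^2. x $ 1 < 0}"
    by (auto intro!: open_Collect_less continuous_intros)
  then have mS: "S \<in> sets lebesgue" "S2 \<in> sets lebesgue"
    unfolding S_def S2_def using cl by (auto intro!: sets.Int)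
  have vS: "(\<lambda>x. v (of_plane x)) absolutely_integrable_on S" "(\<lambda>x. v (of_plane x)) absolutely_integrable_on S2"
    using vD mS by (auto intro: absolutely_integrable_subset_lebesgue simp: S_def S2_def)
  \<comment> \<open>The omitted ray is the image of the imaginary axis. Off the ray the principal
    square root has positive real part, which gives the preimage in \<open>S\<close>.\<close>
  have img: "plane_sq c ` S = of_plane -` D - {x. x $ 2 = Im c \<and> x $ 1 \<le> Re c}"
  proof (intro equalityI subsetI)
    fix y assume "y \<in> plane_sq c ` S"
    then obtain x where x: "x \<in> S" "y = plane_sq c x" by auto
    then have "of_plane y \<in> D" by (simp add: S_def D'_def of_plane_sq)
    moreover have "\<not> (y $ 2 = Im c \<and> y $ 1 \<le> Re c)"
      using x unfolding S_def plane_sq_def by auto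
    ultimately show "y \<in> of_plane -` D - {x. x $ 2 = Im c \<and> x $ 1 \<le> Re c}" by auto
  next
    fix y assume y: "y \<in> of_plane -` D - {x. x $ 2 = Im c \<and> x $ 1 \<le> Re c}"
    define w where "w = csqrt (of_plane y - c)"
    have w2: "w\<^sup>2 + c = of_plane y" by (simp add: w_def)
    have "Re w > 0"
    proof (rule ccontr)
      assume "\<not> Re w > 0"
      moreover have "Re w \<ge> 0" unfolding w_def using csqrt_principal[of "of_plane y - c"] by auto
      ultimately have "Re w = 0" by simp
      then have "Re (w\<^sup>2) \<le> 0" "Im (w\<^sup>2) = 0" by (auto simp: power2_eq_square)
      moreover have "w\<^sup>2 = of_plane y - c" using w2 by (simp add: algebra_simps)
      ultimately show False using y by (auto simp: of_plane_def)
    qed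
    define x :: "real^2" where "x = (\<chi> i. if i = 1 then Re w else Im w)"
    have x1: "x $ 1 = Re w" by (simp add: x_def)
    have x: "of_plane x = w" by (simp add: x_def of_plane_def)
    have "of_plane (plane_sq c x) = of_plane y" by (simp add: of_plane_sq x w2)
    then have "plane_sq c x = y" by (auto simp: of_plane_def vec_eq_iff forall_2)
    moreover have "x \<in> S" using \<open>Re w > 0\<close> y w2 by (auto simp: S_def D'_def x x1)
    ultimately show "y \<in> plane_sq c ` S" by blast
  qed
  have neg: "negligible {x::real^2. x $ 2 = Im c \<and> x $ 1 \<le> Re c}"
  proof (rule negligible_subset)
    show "negligible {x::real^2. axis 2 1 \<bullet> x = Im c}"
      by (rule negligible_hyperplane) (simp add: axis_eq_0_iff)
  qed (auto simp: inner_axis')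
  have m1: "of_plane -` D - {x. x $ 2 = Im c \<and> x $ 1 \<le> Re c} \<in> sets lebesgue"
    using borel_closed[OF compact_imp_closed[OF compact_vimage_of_plane[OF D]]] negligible_imp_sets[OF neg]
    by (intro sets.Diff) auto
  have uI: "(\<lambda>x. u (of_plane x)) absolutely_integrable_on (plane_sq c ` S)"
    unfolding img using uD m1 by (rule absolutely_integrable_subset_lebesgue) auto
  have "inj_on (plane_sq c) S"
    using inj_on_plane_sq by (rule inj_on_subset) (auto simp: S_def)
  note cv = change_of_variables_real_valued[OF mS(1) has_derivative_plane_sq this uI, unfolded det_plane_sq]
  have im2: "uminus ` S = S2"
  proof -
    have e: "of_plane (- x) = - of_plane x" for x by (simp add: of_plane_def complex_eq_iff)
    have "x \<in> uminus ` S \<longleftrightarrow> - x \<in> S" for x by (metis image_eqI imageE minus_minus)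
    moreover have "- x \<in> S \<longleftrightarrow> x \<in> S2" for x by (simp add: S_def S2_def D'_def e)
    ultimately show ?thesis by blast
  qed
  have refl: "(\<lambda>x. v (- of_plane x)) absolutely_integrable_on S"
    "integral S (\<lambda>x. v (- of_plane x)) = integral S2 (\<lambda>x. v (of_plane x))"
  proof -
    have e: "of_plane (- x) = - of_plane x" for x by (simp add: of_plane_def complex_eq_iff)
    show "(\<lambda>x. v (- of_plane x)) absolutely_integrable_on S"
      "integral S (\<lambda>x. v (- of_plane x)) = integral S2 (\<lambda>x. v (of_plane x))"
      using integral_reflect_plane[OF mS(1), of "\<lambda>x. v (of_plane x)"] vS(2) im2 by (simp_all add: e)
  qed
  have "plane_int D u = integral (plane_sq c ` S) (\<lambda>x. u (of_plane x))"
    unfolding plane_int_def img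
    by (rule integral_spike_set; rule negligible_subset[OF neg]) auto
  also have "\<dots> = integral S (\<lambda>x. \<bar>4 * (norm (of_plane x))\<^sup>2\<bar> * u (of_plane (plane_sq c x)))"
    using cv(2) by simp
  also have "\<dots> \<le> integral S (\<lambda>x. v (of_plane x) + v (- of_plane x))"
  proof (rule integral_le)
    show "(\<lambda>x. \<bar>4 * (norm (of_plane x))\<^sup>2\<bar> * u (of_plane (plane_sq c x))) integrable_on S"
      using cv(1) by (simp add: absolutely_integrable_on_def)
    show "(\<lambda>x. v (of_plane x) + v (- of_plane x)) integrable_on S"
      using vS(1) refl(1) by (auto simp: absolutely_integrable_on_def intro: integrable_add)
    fix x assume "x \<in> S"
    moreover from this have "of_plane x \<noteq> 0" by (auto simp: S_def of_plane_def complex_eq_iff)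
    ultimately show "\<bar>4 * (norm (of_plane x))\<^sup>2\<bar> * u (of_plane (plane_sq c x)) \<le> v (of_plane x) + v (- of_plane x)"
      using le[of "of_plane x"] by (simp add: of_plane_sq S_def D'_def)
  qed
  also have "\<dots> = integral S (\<lambda>x. v (of_plane x)) + integral S2 (\<lambda>x. v (of_plane x))"
    using vS(1) refl by (simp add: absolutely_integrable_on_def integral_add)
  also have "\<dots> = integral (S \<union> S2) (\<lambda>x. v (of_plane x))"
  proof -
    have "S \<inter> S2 = {}" by (auto simp: S_def S2_def)
    then show ?thesis using vS by (subst integral_Un) (auto simp: absolutely_integrable_on_def)
  qed
  also have "\<dots> = plane_int D' v"
    unfolding plane_int_def
    by (rule integral_spike_set;
        rule negligible_subset[OF negligible_standard_hyperplane_cart[of 1]]) (auto simp: S_def S2_def)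
  finally show ?thesis by (simp add: D'_def)
qed

text \<open>The axis-parallel square of side \<open>\<tau>\<close> centred at \<open>\<zeta>\<close>
  has half-diagonal below \<open>\<tau>\<close>, so it lies in the ball. It is disjoint from
  \<open>T\<close> and has area \<open>\<tau>\<^sup>2\<close>.\<close>

lemma plane_int_ge_square:
  assumes "compact S" "continuous_on S F" "\<And>z. z \<in> S \<Longrightarrow> F z \<ge> 0" "compact T" "T \<subseteq> S"
    and "ball \<zeta> \<tau> \<subseteq> S - T" "\<And>z. z \<in> ball \<zeta> \<tau> \<Longrightarrow> F z \<ge> m" "\<tau> > 0"
  shows "plane_int T F + m * \<tau>\<^sup>2 \<le> plane_int S F"
proof -
  define a b :: "real^2" where "a = (\<chi> i. if i = 1 then Re \<zeta> - \<tau>/2 else Im \<zeta> - \<tau>/2)"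
    and "b = (\<chi> i. if i = 1 then Re \<zeta> + \<tau>/2 else Im \<zeta> + \<tau>/2)"
  have sub: "of_plane x \<in> ball \<zeta> \<tau>" if "x \<in> cbox a b" for x
  proof -
    from that have "\<bar>x$1 - Re \<zeta>\<bar> \<le> \<tau>/2" "\<bar>x$2 - Im \<zeta>\<bar> \<le> \<tau>/2"
      unfolding abs_le_iff by (auto simp: mem_box_cart a_def b_def forall_2)
    then have "(x$1 - Re \<zeta>)\<^sup>2 \<le> (\<tau>/2)\<^sup>2" "(x$2 - Im \<zeta>)\<^sup>2 \<le> (\<tau>/2)\<^sup>2"
      using \<open>\<tau> > 0\<close> by (metis abs_ge_zero power2_abs power_mono)+
    then have "(norm (of_plane x - \<zeta>))\<^sup>2 \<le> \<tau>\<^sup>2 / 2"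
      by (simp add: cmod_power2 of_plane_def power_divide)
    also have "\<dots> < \<tau>\<^sup>2" using \<open>\<tau> > 0\<close> by simp
    finally have "norm (of_plane x - \<zeta>) < \<tau>" using \<open>\<tau> > 0\<close> by (simp add: power_less_imp_less_base)
    then show ?thesis by (simp add: dist_norm norm_minus_commute)
  qed
  have ct: "measure lborel (cbox a b) = \<tau>\<^sup>2"
  proof -
    have "cbox a b \<noteq> {}" using \<open>\<tau> > 0\<close> by (auto simp: interval_ne_empty_cart a_def b_def)
    then show ?thesis by (simp add: content_cbox_cart a_def b_def UNIV_2 power2_eq_square)
  qed
  have i1: "(\<lambda>x. F (of_plane x)) integrable_on (of_plane -` S)"
    using plane_integrable[OF assms(1,2)] by (simp add: absolutely_integrable_on_def)
  have i2: "(\<lambda>x. F (of_plane x)) integrable_on cbox a b"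
  proof -
    have "cbox a b \<subseteq> of_plane -` S" using sub assms(6) by blast
    then have "(\<lambda>x. F (of_plane x)) absolutely_integrable_on cbox a b"
      using absolutely_integrable_subset_lebesgue[OF plane_integrable[OF assms(1,2)], of "cbox a b"]
        lmeasurable_cbox fmeasurableD by blast
    then show ?thesis by (simp add: absolutely_integrable_on_def)
  qed
  have i3: "(\<lambda>x. F (of_plane x)) integrable_on (of_plane -` T)"
    using plane_integrable[OF assms(4) continuous_on_subset[OF assms(2,5)]]
    by (simp add: absolutely_integrable_on_def)
  have disj: "of_plane -` T \<inter> cbox a b = {}" using sub assms(6) by blast
  have "m * \<tau>\<^sup>2 = integral (cbox a b) (\<lambda>x. m)" by (simp add: ct)
  also have "\<dots> \<le> integral (cbox a b) (\<lambda>x. F (of_plane x))"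
    using i2 sub assms(7) by (intro integral_le) auto
  finally have "plane_int T F + m * \<tau>\<^sup>2 \<le> integral (of_plane -` T \<union> cbox a b) (\<lambda>x. F (of_plane x))"
    unfolding plane_int_def using i2 i3 disj by (subst integral_Un) auto
  also have "\<dots> \<le> plane_int S F"
    unfolding plane_int_def
  proof (rule integral_subset_le[OF _ _ i1])
    show "of_plane -` T \<union> cbox a b \<subseteq> of_plane -` S" using sub assms(5,6) by blast
    show "(\<lambda>x. F (of_plane x)) integrable_on (of_plane -` T \<union> cbox a b)"
      using i2 i3 disj by (intro integrable_Un) auto
  qed (use assms(3) in auto)
  finally show ?thesis .
qed

lemma plane_int_const_le:
  assumes "compact S" "S \<subseteq> cball 0 R" "m \<ge> 0" "R \<ge> 0"
  shows "plane_int S (\<lambda>z. m) \<le> m * (4 * R\<^sup>2)"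
proof -
  define a b :: "real^2" where "a = (\<chi> i. - R)" and "b = (\<chi> i. R)"
  have sub: "of_plane -` S \<subseteq> cbox a b"
  proof
    fix x assume "x \<in> of_plane -` S"
    then have "norm x \<le> R" using assms(2) by (auto simp: norm_of_plane[symmetric])
    then have "\<bar>x $ i\<bar> \<le> R" for i using component_le_norm_cart[of x i] by linarith
    then show "x \<in> cbox a b" by (auto simp: mem_box_cart a_def b_def abs_le_iff minus_le_iff)
  qed
  have ct: "measure lborel (cbox a b) = 4 * R\<^sup>2"
  proof -
    have "cbox a b \<noteq> {}" using \<open>R \<ge> 0\<close> by (auto simp: interval_ne_empty_cart a_def b_def)
    then show ?thesis by (simp add: content_cbox_cart a_def b_def UNIV_2 power2_eq_square)
  qed
  have "plane_int S (\<lambda>z. m) \<le> integral (cbox a b) (\<lambda>x. m)"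
    unfolding plane_int_def
    using plane_integrable[OF assms(1), of "\<lambda>z. m"] assms(3) sub
    by (intro integral_subset_le) (auto simp: absolutely_integrable_on_def)
  then show ?thesis by (simp add: ct mult_ac)
qed

section \<open>Polynomials, zeros and the mass inequality\<close>

lemma entire_lipschitz:
  fixes h :: "complex \<Rightarrow> complex"
  assumes "h holomorphic_on UNIV"
  obtains B where "B \<ge> 1" "\<And>x y. norm x \<le> \<rho> \<Longrightarrow> norm y \<le> \<rho> \<Longrightarrow> norm (h x - h y) \<le> B * norm (x - y)"
proof -
  have "continuous_on (cball 0 \<rho>) (deriv h)"
    using holomorphic_deriv[OF assms] holomorphic_on_imp_continuous_on continuous_on_subset by blast
  then have "bounded (deriv h ` cball 0 \<rho>)"
    by (intro compact_imp_bounded compact_continuous_image) auto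
  then obtain C where C: "\<And>x. norm x \<le> \<rho> \<Longrightarrow> norm (deriv h x) \<le> C"
    unfolding bounded_iff by (metis imageI mem_cball_0)
  have "norm (h x - h y) \<le> max C 1 * norm (x - y)" if "norm x \<le> \<rho>" "norm y \<le> \<rho>" for x y
  proof (rule field_differentiable_bound[of "cball 0 \<rho>" h "deriv h"])
    show "(h has_field_derivative deriv h z) (at z within cball 0 \<rho>)" for z
      using holomorphic_derivI[OF assms] by (auto intro: has_field_derivative_at_within)
    show "norm (deriv h z) \<le> max C 1" if "z \<in> cball 0 \<rho>" for z
      using C[of z] that by auto
  qed (use that in auto)
  then show ?thesis using that[of "max C 1"] by auto
qed

lemma divide_out_zero:
  assumes "F holomorphic_on UNIV" "F \<zeta> = 0"
  obtains G where "G holomorphic_on UNIV" "\<And>z. F z = (z - \<zeta>) * G z"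
proof
  show "(\<lambda>z. if z = \<zeta> then deriv F \<zeta> else (F z - F \<zeta>) / (z - \<zeta>)) holomorphic_on UNIV"
    using pole_lemma_open[OF assms(1)] by auto
qed (use assms(2) in auto)

text \<open>A Schwarz lemma for several zeros. They are removed one at a time: on the circle of
  radius \<open>\<rho>\<close> each factor has modulus at least \<open>\<rho> - r\<close>, and the
  maximum principle carries the bound for the quotient inside.\<close>

lemma divide_out_zeros:
  assumes "finite S" "F holomorphic_on UNIV" "\<And>\<zeta>. \<zeta> \<in> S \<Longrightarrow> F \<zeta> = 0" "S \<subseteq> cball a r" "r < \<rho>"
    and "\<And>z. norm (z - a) \<le> \<rho> \<Longrightarrow> norm (F z) \<le> M"
  shows "\<exists>H. H holomorphic_on UNIV \<and> (\<forall>z. F z = (\<Prod>\<zeta>\<in>S. z - \<zeta>) * H z) \<and>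
           (\<forall>z. norm (z - a) \<le> \<rho> \<longrightarrow> norm (H z) \<le> M / (\<rho> - r) ^ card S)"
  using assms
proof (induction S arbitrary: F M rule: finite_induct)
  case empty
  then show ?case by (intro exI[of _ F]) auto
next
  case (insert \<zeta> S)
  obtain G where G: "G holomorphic_on UNIV" "\<And>z. F z = (z - \<zeta>) * G z"
    using divide_out_zero[OF insert.prems(1), of \<zeta>] insert.prems(2) by auto
  have Gb: "norm (G z) \<le> M / (\<rho> - r)" if z: "norm (z - a) \<le> \<rho>" for z
  proof (rule maximum_modulus_frontier[of G "cball a \<rho>"])
    show "G holomorphic_on interior (cball a \<rho>)" "continuous_on (closure (cball a \<rho>)) G"
      using G(1) by (auto intro: holomorphic_on_subset holomorphic_on_imp_continuous_on continuous_on_subset)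
    show "z \<in> cball a \<rho>" using z by (simp add: dist_norm norm_minus_commute)
    fix w assume "w \<in> frontier (cball a \<rho>)"
    then have w: "norm (w - a) = \<rho>" by (simp add: frontier_cball dist_norm norm_minus_commute)
    have "norm (\<zeta> - a) \<le> r" using insert.prems(3) by (simp add: dist_norm norm_minus_commute)
    then have d: "norm (w - \<zeta>) \<ge> \<rho> - r"
      using w norm_triangle_ineq[of "w - \<zeta>" "\<zeta> - a"] by simp
    have "norm (G w) * (\<rho> - r) \<le> norm (G w) * norm (w - \<zeta>)"
      using d by (intro mult_left_mono) auto
    also have "\<dots> = norm (F w)" by (simp add: G(2) norm_mult)
    also have "\<dots> \<le> M" using insert.prems(5) w by simp
    finally show "norm (G w) \<le> M / (\<rho> - r)" using \<open>r < \<rho>\<close> by (simp add: field_simps)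
  qed auto
  have Gz: "G x = 0" if "x \<in> S" for x
  proof -
    have "(x - \<zeta>) * G x = 0" using G(2)[of x] insert.prems(2)[of x] that by simp
    then show ?thesis using that insert.hyps by auto
  qed
  obtain H where H: "H holomorphic_on UNIV" "\<And>z. G z = (\<Prod>\<zeta>\<in>S. z - \<zeta>) * H z"
     "\<And>z. norm (z - a) \<le> \<rho> \<Longrightarrow> norm (H z) \<le> M / (\<rho> - r) / (\<rho> - r) ^ card S"
    using insert.IH[OF G(1) Gz _ insert.prems(4) Gb] insert.prems(3) by auto
  show ?case
    using H insert.hyps G(2) by (intro exI[of _ H]) (auto simp: mult_ac)
qed

section \<open>Growth of polynomials\<close>

text \<open>Bernstein's growth estimate: the maximum principle for the reversed polynomial on the
  disc of radius \<open>1 / \<rho>\<close>.\<close>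

lemma poly_growth:
  fixes P :: "complex poly"
  assumes "0 < \<rho>" "\<And>z. norm z = \<rho> \<Longrightarrow> norm (poly P z) \<le> M" "\<rho> \<le> norm z" "degree P \<le> N"
  shows "norm (poly P z) \<le> M * (norm z / \<rho>) ^ N"
proof -
  have z: "z \<noteq> 0" using assms by auto
  have M0: "M \<ge> 0" using assms(2)[of "of_real \<rho>"] assms(1) by (simp add: order_trans[OF norm_ge_zero])
  have "norm (poly (reflect_poly P) (inverse z)) \<le> M / \<rho> ^ degree P"
  proof (rule maximum_modulus_frontier[of "poly (reflect_poly P)" "cball 0 (1 / \<rho>)"])
    show "poly (reflect_poly P) holomorphic_on interior (cball 0 (1/\<rho>))"
      by (intro holomorphic_intros)
    show "continuous_on (closure (cball 0 (1/\<rho>))) (poly (reflect_poly P))"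
      by (intro continuous_intros)
    show "inverse z \<in> cball 0 (1/\<rho>)" using assms z le_imp_inverse_le[of \<rho> "norm z"] by (simp add: norm_inverse inverse_eq_divide[symmetric])
    fix u :: complex assume "u \<in> frontier (cball 0 (1/\<rho>))"
    then have u: "norm u = 1 / \<rho>" by (simp add: frontier_cball)
    then have u0: "u \<noteq> 0" using assms by auto
    have "poly (reflect_poly P) u = u ^ degree P * poly P (inverse u)"
      using poly_reflect_poly_nz[OF u0] by simp
    then have "norm (poly (reflect_poly P) u) = norm (poly P (inverse u)) / \<rho> ^ degree P"
      using u by (simp add: norm_mult norm_power power_divide)
    also have "\<dots> \<le> M / \<rho> ^ degree P"
      using assms(1) u by (intro divide_right_mono assms(2)) (auto simp: norm_inverse)
    finally show "norm (poly (reflect_poly P) u) \<le> M / \<rho> ^ degree P" .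
  qed auto
  moreover have "poly P z = z ^ degree P * poly (reflect_poly P) (inverse z)"
    using poly_reflect_poly_nz[of "inverse z" P] z by (simp add: power_inverse)
  ultimately have "norm (poly P z) \<le> norm z ^ degree P * (M / \<rho> ^ degree P)"
    by (metis mult_left_mono norm_ge_zero norm_mult norm_power zero_le_power)
  also have "\<dots> = M * (norm z / \<rho>) ^ degree P" by (simp add: power_divide)
  also have "\<dots> \<le> M * (norm z / \<rho>) ^ N"
    using assms M0 by (intro mult_left_mono power_increasing) auto
  finally show ?thesis .
qed

text \<open>\<open>\<zeta>\<close> maximizes the modulus of \<open>P\<close> on the circle of radius
  \<open>R - 1/2\<close>. As \<open>R\<close> is at most twice that radius, growth beyond the circle
  costs at most \<open>2 ^ N\<close>, which gives \<open>M\<close>. Cauchy's estimate bounds the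
  derivative by \<open>4 * M\<close> up to radius \<open>R - 1/4\<close>, so on the small ball the
  modulus keeps at least half of its value at \<open>\<zeta>\<close>.\<close>

lemma poly_large_on_ball:
  fixes P :: "complex poly"
  assumes "P \<noteq> 0" "degree P \<le> N" "R \<ge> 1"
  obtains M \<zeta> where "M > 0" "\<And>z. norm z \<le> R \<Longrightarrow> norm (poly P z) \<le> M" "norm \<zeta> = R - 1/2"
    "\<And>z. z \<in> ball \<zeta> (1 / (8 * 2 ^ N)) \<Longrightarrow> norm (poly P z) \<ge> M / 2 ^ (N + 1)"
proof -
  define \<rho> where "\<rho> = R - 1/2"
  have \<rho>: "\<rho> > 0" "R \<le> 2 * \<rho>" using assms by (auto simp: \<rho>_def)
  have "compact (sphere 0 \<rho> :: complex set)" "sphere 0 \<rho> \<noteq> ({} :: complex set)" 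
    using \<rho> by auto
  moreover have "continuous_on (sphere 0 \<rho>) (\<lambda>z. norm (poly P z))" by (intro continuous_intros)
  ultimately obtain \<zeta> where \<zeta>: "norm \<zeta> = \<rho>" and max: "\<And>z. norm z = \<rho> \<Longrightarrow> norm (poly P z) \<le> norm (poly P \<zeta>)"
    using continuous_attains_sup[of "sphere 0 \<rho>" "\<lambda>z. norm (poly P z)"] by auto
  define M' where "M' = norm (poly P \<zeta>)"
  define M where "M = M' * 2 ^ N"
  have out: "norm (poly P z) \<le> M" if "\<rho> \<le> norm z" "norm z \<le> R" for z
  proof -
    have "norm (poly P z) \<le> M' * (norm z / \<rho>) ^ N"
      using poly_growth[OF \<rho>(1) max that(1) assms(2)] by (simp add: M'_def)
    also have "\<dots> \<le> M' * 2 ^ N"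
      using that \<rho> by (intro mult_left_mono power_mono) (auto simp: M'_def field_simps)
    finally show ?thesis by (simp add: M_def)
  qed
  have ins: "norm (poly P z) \<le> M" if "norm z \<le> \<rho>" for z
  proof -
    have "norm (poly P z) \<le> M'"
      by (rule maximum_modulus_frontier[of "poly P" "cball 0 \<rho>"])
         (use that max in \<open>auto simp: M'_def frontier_cball intro!: holomorphic_intros continuous_intros\<close>)
    also have "\<dots> \<le> M" using mult_left_mono[of 1 "2^N" M'] by (simp add: M_def M'_def)
    finally show ?thesis .
  qed
  have all: "norm (poly P z) \<le> M" if "norm z \<le> R" for z
    using out[of z] ins[of z] that by linarith
  have M'0: "M' > 0"
  proof (rule ccontr)
    assume "\<not> M' > 0"
    then have "\<And>z. norm z \<le> \<rho> \<Longrightarrow> poly P z = 0"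
      using ins by (auto simp: M_def M'_def)
    then have "ball 0 \<rho> \<subseteq> {z. poly P z = 0}" by auto
    moreover have "infinite (ball (0::complex) \<rho>)"
      using \<rho> by (simp add: uncountable_ball uncountable_infinite)
    ultimately show False using poly_roots_finite[OF assms(1)] finite_subset by blast
  qed
  have der: "norm (poly (pderiv P) z) \<le> 4 * M" if "norm z \<le> R - 1/4" for z
  proof -
    have "norm ((deriv ^^ 1) (poly P) z) \<le> fact 1 * M / (1/4) ^ 1"
    proof (rule Cauchy_inequality)
      fix x assume "norm (z - x) = 1/4"
      then have "norm x \<le> R" using that norm_triangle_ineq4[of z "z - x"] by simp
      then show "norm (poly P x) \<le> M" using all by simp
    qed (auto intro!: holomorphic_intros continuous_intros)
    then show ?thesis by (simp add: DERIV_imp_deriv[OF poly_DERIV])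
  qed
  have low: "norm (poly P z) \<ge> M / 2 ^ (N + 1)" if z: "z \<in> ball \<zeta> (1 / (8 * 2 ^ N))" for z
  proof -
    have d: "norm (z - \<zeta>) < 1 / (8 * 2 ^ N)" using z by (simp add: dist_norm norm_minus_commute)
    also have "\<dots> \<le> 1/8" by (simp add: field_simps)
    finally have nz: "norm (z - \<zeta>) \<le> 1/8" by simp
    have "norm (poly P z - poly P \<zeta>) \<le> (4 * M) * norm (z - \<zeta>)"
    proof (rule field_differentiable_bound[of "cball 0 (R - 1/4)" "poly P" "poly (pderiv P)"])
      show "z \<in> cball 0 (R - 1/4)" 
        using nz \<zeta> norm_triangle_ineq[of "z - \<zeta>" \<zeta>] by (simp add: \<rho>_def)
      show "\<zeta> \<in> cball 0 (R - 1/4)" using \<zeta> by (simp add: \<rho>_def)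
    qed (use der in \<open>auto intro!: poly_DERIV has_field_derivative_at_within\<close>)
    also have "\<dots> \<le> (4 * M) * (1 / (8 * 2 ^ N))"
      using d M'0 by (intro mult_left_mono) (auto simp: M_def)
    also have "\<dots> = M' / 2" by (simp add: M_def)
    finally have "norm (poly P z) \<ge> M' / 2"
      using norm_triangle_ineq2[of "poly P \<zeta>" "poly P z"] by (simp add: M'_def norm_minus_commute)
    then show ?thesis by (simp add: M_def)
  qed
  show ?thesis using that[of M \<zeta>] M'0 all low \<zeta> by (simp add: M_def \<rho>_def)
qed

section \<open>The mass inequality for the quadratic map\<close>

text \<open>Here \<open>ph\<close> stands for the modulus of a rational function, \<open>er\<close>
  for the error of its push-forward and \<open>wt\<close> for a cut-off around the poles. The
  weighted mass of the disc is compared with that of its preimage: the transfer costs at most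
  \<open>E\<close> pointwise, replacing \<open>wt (f w)\<close> by \<open>wt w\<close> at most
  \<open>G\<close>, and the disc exceeds its preimage at least by the ball around
  \<open>\<zeta>\<close>.\<close>

lemma quadratic_contraction:
  fixes ph er wt :: "complex \<Rightarrow> real" and c :: complex
  defines "f \<equiv> \<lambda>w. w\<^sup>2 + c"
  assumes R: "R \<ge> norm c + 4"
    and cont: "continuous_on (cball 0 R) (\<lambda>z. wt z * ph z)" "continuous_on (cball 0 R) (\<lambda>z. wt z * er z)"
      "continuous_on {w. f w \<in> cball 0 R} (\<lambda>w. wt (f w) * ph w)"
    and pos: "\<And>z. wt z \<ge> 0" "\<And>z. ph z \<ge> 0"
    and push: "\<And>w. w \<noteq> 0 \<Longrightarrow> f w \<in> cball 0 R \<Longrightarrow> wt (f w) > 0 \<Longrightarrow>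
        4 * (norm w)\<^sup>2 * (ph (f w) - er (f w)) \<le> ph w + ph (- w)"
    and E: "\<And>z. norm z \<le> R \<Longrightarrow> wt z * er z \<le> E" "E \<ge> 0"
    and G: "\<And>w. norm w \<le> R \<Longrightarrow> (wt (f w) - wt w) * ph w \<le> G" "G \<ge> 0"
    and \<zeta>: "norm \<zeta> = R - 1/2" "0 < \<tau>" "\<tau> \<le> 1/4" "\<And>z. z \<in> ball \<zeta> \<tau> \<Longrightarrow> wt z * ph z \<ge> m" "m \<ge> 0"
  shows "m * \<tau>\<^sup>2 \<le> (E + G) * (4 * R\<^sup>2)"
proof -
  define D where "D = cball (0::complex) R"
  define D' where "D' = {w. f w \<in> D}"
  \<comment> \<open>The hypothesis on \<open>R\<close> gives
    \<open>R + norm c \<le> 2 * R - 4\<close>, and \<open>(R - 3/4)\<^sup>2\<close> is larger still.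
    So the preimage of the disc lies well inside the disc.\<close>
  have far: "norm (f w) > R" if "norm w \<ge> R - 3/4" for w
  proof -
    have "(R - 3/4)\<^sup>2 \<le> (norm w)\<^sup>2" using that R norm_ge_zero[of c] by (intro power_mono) linarith+
    moreover have "norm (f w) \<ge> (norm w)\<^sup>2 - norm c"
      using norm_diff_ineq[of "w\<^sup>2" c] by (simp add: f_def norm_power)
    moreover have "(R - 3/4)\<^sup>2 > 2 * R - 4"
      using sum_power2_gt_zero_iff[of "R - 7/4" 1] by (simp add: power2_eq_square algebra_simps)
    ultimately show ?thesis using R by linarith
  qed
  have D'sub: "D' \<subseteq> cball 0 (R - 3/4)" 
  proof
    fix w assume "w \<in> D'"
    then have "norm (f w) \<le> R" by (simp add: D'_def D_def)
    then show "w \<in> cball 0 (R - 3/4)" using far[of w] by (cases "R - 3/4 \<le> norm w") auto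
  qed
  have cf: "continuous_on UNIV f" unfolding f_def by (intro continuous_intros)
  have "closed D'"
    using continuous_closed_vimage[of D f] cf
    by (auto simp: D'_def D_def vimage_def continuous_on_eq_continuous_at)
  then have cD': "compact D'"
    using D'sub by (meson bounded_cball bounded_subset compact_eq_bounded_closed)
  have cD: "compact D" by (simp add: D_def)
  have D'D: "D' \<subseteq> D" using D'sub by (auto simp: D_def)
  note co = cont[folded D_def, folded D'_def]
  have c1: "continuous_on D' (\<lambda>z. wt z * ph z)" using co(1) D'D continuous_on_subset by blast
  have a1: "plane_int D (\<lambda>z. wt z * ph z) - plane_int D (\<lambda>z. wt z * er z) \<le> plane_int D' (\<lambda>w. wt (f w) * ph w)"
  proof -
    have "plane_int D (\<lambda>z. wt z * ph z - wt z * er z) \<le> plane_int {w. w\<^sup>2 + c \<in> D} (\<lambda>w. wt (f w) * ph w)"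
    proof (rule plane_int_square_transfer[OF cD])
      show "continuous_on D (\<lambda>z. wt z * ph z - wt z * er z)" using co by (intro continuous_on_diff)
      show "compact {w. w\<^sup>2 + c \<in> D}" using cD' by (simp add: D'_def f_def)
      show "continuous_on {w. w\<^sup>2 + c \<in> D} (\<lambda>w. wt (f w) * ph w)" using co by (simp add: D'_def f_def)
      fix w :: complex assume w: "w \<noteq> 0" "w\<^sup>2 + c \<in> D"
      have fm: "f (- w) = f w" by (simp add: f_def)
      have "4 * (norm w)\<^sup>2 * (wt (f w) * ph (f w) - wt (f w) * er (f w)) \<le> wt (f w) * (ph w + ph (- w))"
      proof (cases "wt (f w) > 0")
        case True
        have "wt (f w) * (4 * (norm w)\<^sup>2 * (ph (f w) - er (f w))) \<le> wt (f w) * (ph w + ph (- w))"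
          using push[OF w(1)] w(2) True by (intro mult_left_mono) (auto simp: f_def D_def)
        then show ?thesis by (simp add: algebra_simps)
      next
        case False
        then have "wt (f w) = 0" using pos(1)[of "f w"] by linarith
        then show ?thesis by simp
      qed
      then show "4 * (norm w)\<^sup>2 * (wt (w\<^sup>2 + c) * ph (w\<^sup>2 + c) - wt (w\<^sup>2 + c) * er (w\<^sup>2 + c))
          \<le> wt (f w) * ph w + wt (f (- w)) * ph (- w)"
        unfolding fm by (simp add: f_def algebra_simps)
    qed
    then show ?thesis using plane_int_diff[OF cD co(1,2)] by (simp add: D'_def f_def)
  qed
  have R0: "R \<ge> 0" using R norm_ge_zero[of c] by linarith
  have a2: "plane_int D (\<lambda>z. wt z * er z) \<le> E * (4 * R\<^sup>2)"
  proof -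
    have "plane_int D (\<lambda>z. wt z * er z) \<le> plane_int D (\<lambda>z. E)"
      using E co by (intro plane_int_mono cD) (auto simp: D_def)
    also have "\<dots> \<le> E * (4 * R\<^sup>2)"
      using R0 E by (intro plane_int_const_le cD) (auto simp: D_def)
    finally show ?thesis .
  qed
  have a3: "plane_int D' (\<lambda>w. wt (f w) * ph w) - plane_int D' (\<lambda>w. wt w * ph w) \<le> G * (4 * R\<^sup>2)"
  proof -
    have "plane_int D' (\<lambda>w. wt (f w) * ph w) - plane_int D' (\<lambda>w. wt w * ph w)
        = plane_int D' (\<lambda>w. wt (f w) * ph w - wt w * ph w)"
      using plane_int_diff[OF cD' co(3) c1] by simp
    also have "\<dots> \<le> plane_int D' (\<lambda>w. G)"
      using G(1) D'D c1 co(3) 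
      by (intro plane_int_mono cD') (auto simp: D_def subset_iff left_diff_distrib intro!: continuous_on_diff)
    also have "\<dots> \<le> G * (4 * R\<^sup>2)"
      using R0 G D'D by (intro plane_int_const_le cD') (auto simp: D_def)
    finally show ?thesis .
  qed
  define w0 where "w0 = (\<lambda>z. wt z * ph z)"
  have a4: "plane_int D' w0 + m * \<tau>\<^sup>2 \<le> plane_int D w0"
  proof -
    \<comment> \<open>Points of the ball have modulus above \<open>R - 3/4\<close>, because
      \<open>\<tau> \<le> 1/4\<close>.\<close>
    have "D' \<inter> ball \<zeta> \<tau> = {}"
    proof (rule equals0I)
      fix z assume "z \<in> D' \<inter> ball \<zeta> \<tau>"
      then have "norm z \<le> R - 3/4" "norm (\<zeta> - z) < \<tau>" using D'sub by (auto simp: dist_norm)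
      then show False using \<zeta> norm_triangle_ineq[of "\<zeta> - z" z] by simp
    qed
    moreover have "ball \<zeta> \<tau> \<subseteq> D"
    proof
      fix z assume "z \<in> ball \<zeta> \<tau>"
      then have "norm (z - \<zeta>) < \<tau>" by (simp add: dist_norm norm_minus_commute)
      then show "z \<in> D" using \<zeta> norm_triangle_ineq[of "z - \<zeta>" \<zeta>] by (simp add: D_def)
    qed
    ultimately show ?thesis
      using \<zeta> pos co(1) D'D unfolding w0_def
      by (intro plane_int_ge_square[where \<zeta> = \<zeta>] cD cD') auto
  qed
  from a1 a2 a3 a4 show ?thesis by (simp add: w0_def algebra_simps)
qed

section \<open>Iteration near an indifferent cycle\<close>

lemma funpow_fixed_mult: "(f ^^ m) w = w \<Longrightarrow> (f ^^ (m * k)) w = w"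
  by (induction k) (auto simp: funpow_add)

text \<open>\<open>l\<close> can be completed to a multiple of \<open>m\<close>, so some iterate
  leads from \<open>(f ^^ l) w\<close> back to \<open>w\<close>; it commutes with
  \<open>f ^^ k\<close>.\<close>

lemma funpow_period_shift:
  assumes "(f ^^ m) w = w" "m > 0" "(f ^^ k) ((f ^^ l) w) = (f ^^ l) w"
  shows "(f ^^ k) w = w"
proof -
  have "l \<le> m * l" using assms(2) by simp
  then obtain j where j: "m * l = j + l" by (metis le_add_diff_inverse2)
  have w: "(f ^^ j) ((f ^^ l) w) = w"
    using funpow_fixed_mult[OF assms(1), of l] by (simp add: j funpow_add)
  have "(f ^^ k) w = (f ^^ (k + j)) ((f ^^ l) w)"
    using w by (simp add: funpow_add)
  also have "\<dots> = (f ^^ j) ((f ^^ k) ((f ^^ l) w))"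
    by (subst add.commute) (simp add: funpow_add)
  finally show ?thesis using assms(3) w by simp
qed

lemma minimal_period_inj:
  assumes "minimal_period f m w"
  shows "inj_on (\<lambda>k. (f ^^ k) w) {..<m}"
proof (rule linorder_inj_onI')
  fix i j assume ij: "i \<in> {..<m}" "j \<in> {..<m}" "i < j"
  show "(f ^^ i) w \<noteq> (f ^^ j) w"
  proof
    assume e: "(f ^^ i) w = (f ^^ j) w"
    have "(f ^^ j) w = (f ^^ (j - i)) ((f ^^ i) w)"
      using ij by (metis comp_apply funpow_add le_add_diff_inverse2 less_imp_le_nat)
    then have "(f ^^ (j - i)) w = w"
      using assms e funpow_period_shift[of m f w "j - i" i] unfolding minimal_period_def by simp
    then show False using assms ij unfolding minimal_period_def by simp
  qed
qed

lemma quadratic_iter_deriv: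
  fixes c :: complex
  defines "f \<equiv> \<lambda>z. z\<^sup>2 + c"
  shows "((f ^^ k) has_field_derivative (\<Prod>i<k. 2 * (f ^^ i) x)) (at x)"
proof (induction k)
  case 0 then show ?case by (simp add: id_def)
next
  case (Suc k)
  have "(f has_field_derivative 2 * (f ^^ k) x) (at ((f ^^ k) x))"
    unfolding f_def by (auto intro!: derivative_eq_intros)
  from DERIV_chain2[OF this Suc] show ?case by (simp add: mult_ac)
qed

text \<open>Gathers the constants that depend on the cycle only. \<open>a\<close> is indexed by all
  naturals and periodic modulo \<open>p\<close>; \<open>D k\<close> is the derivative of
  \<open>f ^^ k\<close>. \<open>B\<close> controls the return map \<open>f ^^ p\<close> and its
  derivative near the cycle, \<open>L\<close> the iterates up to \<open>p\<close>, and
  \<open>R\<close> is an escape radius.\<close>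

locale quadratic_cycle =
  fixes f :: "complex \<Rightarrow> complex" and c z0 lam :: complex and p :: nat and B L \<sigma> R :: real
    and a :: "nat \<Rightarrow> complex" and D :: "nat \<Rightarrow> complex \<Rightarrow> complex"
  defines "a \<equiv> \<lambda>i. (f ^^ i) z0"
    and "D \<equiv> \<lambda>k w. \<Prod>i<k. 2 * (f ^^ i) w"
  assumes f_eq: "f = (\<lambda>z. z\<^sup>2 + c)"
    and p_pos: "p > 0" and period: "(f ^^ p) z0 = z0"
    and sep: "\<And>i j. i mod p \<noteq> j mod p \<Longrightarrow> 4 * \<sigma> \<le> norm (a i - a j)"
    and sigma: "0 < \<sigma>" "\<sigma> \<le> 1"
    and lam: "norm lam = 1"
    and multiplier: "D p z0 = lam"
    and B: "B \<ge> 1" and L: "L \<ge> 1"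
    and deriv_near: "\<And>x i. norm (x - a i) \<le> 1 \<Longrightarrow> norm (D p x - lam) \<le> B * norm (x - a i)"
    and iterate_near: "\<And>x i. norm (x - a i) \<le> 1 \<Longrightarrow>
          norm ((f ^^ p) x - a i - lam * (x - a i)) \<le> B * (norm (x - a i))\<^sup>2"
    and lipschitz: "\<And>x i j. norm (x - a i) \<le> 1 \<Longrightarrow> j \<le> p \<Longrightarrow>
          norm ((f ^^ j) x - a (i + j)) \<le> L * norm (x - a i)"
    and R: "R \<ge> norm c + 4" and a_bound: "\<And>i. norm (a i) \<le> R - 4"
begin

lemma iter_add: "(f ^^ (m + k)) x = (f ^^ m) ((f ^^ k) x)"
  by (simp add: funpow_add)

lemma iter_mult: "(f ^^ (p * Suc k)) x = (f ^^ p) ((f ^^ (p * k)) x)"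
  by (metis iter_add mult_Suc_right)

lemma a_add: "a (m + k) = (f ^^ m) (a k)"
  by (simp add: a_def iter_add)

lemma a_mod: "a (i mod p) = a i"
  using funpow_mod_eq[OF period, symmetric] by (simp add: a_def)

lemma a_cong: "i mod p = j mod p \<Longrightarrow> a i = a j"
  by (metis a_mod)

lemma a_add_period: "a (i + p * k) = a i"
  by (rule a_cong) simp

lemma iter_a_period: "(f ^^ (p * k)) (a i) = a i"
  by (metis a_add a_add_period add.commute)

lemma has_deriv_iter: "((f ^^ k) has_field_derivative D k x) (at x)"
  unfolding D_def f_eq by (rule quadratic_iter_deriv)

lemma holomorphic_iter: "(f ^^ k) holomorphic_on UNIV"
  using has_deriv_iter by (auto simp: holomorphic_on_def field_differentiable_def)

lemma continuous_iter: "continuous_on UNIV (f ^^ k)"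
  by (rule holomorphic_on_imp_continuous_on[OF holomorphic_iter])

lemma D_add: "D (m + k) x = D m ((f ^^ k) x) * D k x"
  by (induction m) (auto simp: D_def funpow_add mult_ac)

text \<open>The linear part of the return map preserves distances, so one return adds at most the
  quadratic term \<open>B * (2 * u)\<^sup>2 \<le> u / n\<close>. Up to \<open>n\<close> returns
  therefore at most double the distance, which is what bounds the quadratic term.\<close>

lemma near_iter_period:
  fixes n k :: nat
  assumes "n \<ge> 1" "k \<le> n" "norm (x - a i) \<le> 1 / (4 * B * n)"
  shows "norm ((f ^^ (p * k)) x - a i) \<le> (1 + k / n) * norm (x - a i)"
  using assms(2)
proof (induction k)
  case 0 then show ?case by simp
next
  case (Suc k)
  define u where "u = norm (x - a i)"
  define y where "y = (f ^^ (p * k)) x"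
  have y: "norm (y - a i) \<le> (1 + k / n) * u" using Suc by (simp add: y_def u_def)
  also have "\<dots> \<le> 2 * u" using Suc.prems assms(1) by (intro mult_right_mono) (auto simp: u_def)
  finally have y2: "norm (y - a i) \<le> 2 * u" .
  have u1: "4 * B * n * u \<le> 1" using assms B by (simp add: u_def field_simps)
  have "4 * u * 1 \<le> 4 * u * (B * n)" using B assms(1) mult_mono[of 1 B 1 "real n"]
    by (intro mult_left_mono) (auto simp: u_def)
  then have u2: "4 * u \<le> 1" using u1 by (simp add: mult_ac)
  have "norm ((f ^^ p) y - a i) \<le> norm ((f ^^ p) y - a i - lam * (y - a i)) + norm (lam * (y - a i))"
    by (metis diff_add_cancel norm_triangle_ineq)
  also have "\<dots> \<le> B * (norm (y - a i))\<^sup>2 + norm (y - a i)"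
    using iterate_near[of y i] y2 u2 by (simp add: norm_mult lam)
  also have "\<dots> \<le> B * (2 * u)\<^sup>2 + (1 + k / n) * u"
    using y y2 B by (intro add_mono mult_left_mono power_mono) auto
  also have "B * (2 * u)\<^sup>2 \<le> u / n"
  proof -
    have "(4 * B * n * u) * u \<le> 1 * u" using u1 by (intro mult_right_mono) (auto simp: u_def)
    then show ?thesis using assms(1) by (simp add: field_simps power2_eq_square)
  qed
  finally have "norm ((f ^^ p) y - a i) \<le> (1 + Suc k / n) * u" 
    using assms(1) by (simp add: field_simps)
  then show ?case by (simp only: iter_mult y_def u_def)
qed

lemma near_iter_period_double:
  fixes n k :: nat
  assumes "n \<ge> 1" "k \<le> n" "norm (x - a i) \<le> 1 / (4 * B * n)"
  shows "norm ((f ^^ (p * k)) x - a i) \<le> 2 * norm (x - a i)"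
proof -
  have "(1 + k / n) * norm (x - a i) \<le> 2 * norm (x - a i)"
    using assms by (intro mult_right_mono) auto
  then show ?thesis using near_iter_period[OF assms] by linarith
qed

lemma quarter_bound:
  fixes n :: nat
  assumes "n \<ge> 1" shows "1 / (4 * B * n) \<le> 1 / 4"
proof -
  have "1 * 1 \<le> B * real n" using B assms by (intro mult_mono) auto
  then show ?thesis by (simp add: field_simps)
qed

text \<open>Split \<open>m\<close> into full returns, which at most double the distance, and fewer
  than \<open>p\<close> further steps, which cost the factor \<open>L\<close>.\<close>

lemma near_iter:
  fixes n :: nat
  assumes "n \<ge> 1" "m \<le> p * n" "norm (x - a i) \<le> 1 / (4 * B * n)"
  shows "norm ((f ^^ m) x - a (i + m)) \<le> 2 * L * norm (x - a i)"
proof -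
  define k where "k = m div p"
  define y where "y = (f ^^ (p * k)) x"
  have m: "m = m mod p + p * k" by (simp add: k_def)
  have "k \<le> n" using assms(2) p_pos unfolding k_def by (metis div_le_mono nonzero_mult_div_cancel_left less_numeral_extra(3))
  then have y: "norm (y - a i) \<le> 2 * norm (x - a i)"
    using near_iter_period_double assms by (simp add: y_def)
  moreover have "norm (y - a i) \<le> 1" using y assms(3) quarter_bound[OF assms(1)] by linarith
  ultimately have "norm ((f ^^ (m mod p)) y - a (i + m mod p)) \<le> L * norm (y - a i)"
    using lipschitz p_pos by (simp add: less_imp_le)
  also have "\<dots> \<le> L * (2 * norm (x - a i))" using y L by (intro mult_left_mono) auto
  also have "(f ^^ (m mod p)) y = (f ^^ m) x" using m iter_add unfolding y_def by metis
  also have "a (i + m mod p) = a (i + m)" by (rule a_cong) (simp add: mod_add_right_eq)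
  finally show ?thesis by (simp add: mult_ac)
qed

text \<open>By the chain rule one more return multiplies by a number within \<open>2 * B * u\<close>
  of \<open>lam\<close>, while the product so far has modulus at most 2. So each return adds at most
  \<open>4 * B * u\<close> to the error.\<close>

lemma near_D:
  fixes n k :: nat
  assumes "n \<ge> 1" "k \<le> n" "4 * B * n * u \<le> 1" "norm (x - a i) \<le> u"
  shows "norm (D (p * k) x - lam ^ k) \<le> 4 * B * k * u"
  using assms(2)
proof (induction k)
  case 0 then show ?case by (simp add: D_def)
next
  case (Suc k)
  have u0: "u \<ge> 0" using assms(4) norm_ge_zero order_trans by blast
  define y where "y = (f ^^ (p * k)) x"
  have xu: "norm (x - a i) \<le> 1 / (4 * B * n)"
  proof -
    have "norm (x - a i) * (4 * B * n) \<le> u * (4 * B * n)" using assms(4) B by (intro mult_right_mono) auto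
    also have "\<dots> \<le> 1" using assms(3) by (simp add: mult_ac)
    finally show ?thesis using assms(1) B by (subst pos_le_divide_eq) auto
  qed
  then have y: "norm (y - a i) \<le> 2 * u" using near_iter_period_double[of n k x i] Suc.prems assms(1,4) by (simp add: y_def)
  have y1: "norm (y - a i) \<le> 1"
    using near_iter_period_double[of n k x i] xu quarter_bound[OF assms(1)] Suc.prems assms(1) by (simp add: y_def)
  have IH: "norm (D (p * k) x - lam ^ k) \<le> 4 * B * k * u" using Suc by simp
  have "4 * B * k * u \<le> 4 * B * n * u" using Suc.prems B u0 by (intro mult_right_mono mult_left_mono) auto
  then have D2: "norm (D (p * k) x) \<le> 2"
    using IH assms(3) norm_triangle_ineq2[of "D (p * k) x" "lam ^ k"] by (simp add: norm_power lam)
  have "D (p * Suc k) x - lam ^ Suc k = (D p y - lam) * D (p * k) x + lam * (D (p * k) x - lam ^ k)"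
    using D_add[of p "p * k" x] by (simp add: y_def algebra_simps)
  then have "norm (D (p * Suc k) x - lam ^ Suc k) \<le> norm (D p y - lam) * norm (D (p * k) x) + norm (D (p * k) x - lam ^ k)"
    by (metis lam mult_1 norm_mult norm_triangle_ineq)
  also have "\<dots> \<le> (B * (2 * u)) * 2 + 4 * B * k * u"
  proof (intro add_mono mult_mono IH D2)
    have "norm (D p y - lam) \<le> B * norm (y - a i)" using deriv_near y1 by blast
    also have "\<dots> \<le> B * (2 * u)" using y B by (intro mult_left_mono) auto
    finally show "norm (D p y - lam) \<le> B * (2 * u)" .
  qed (use B u0 in auto)
  also have "\<dots> = 4 * B * Suc k * u" by (simp add: algebra_simps)
  finally show ?case .
qed

text \<open>If the return map \<open>h = f ^^ (p * k)\<close> moved \<open>w\<close> only slightly, it would be so close to the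
  identity that the increments along the \<open>h\<close>-orbit of \<open>w\<close> would all nearly agree and could not add up to zero.\<close>

lemma return_separation:
  fixes n k :: nat
  assumes n: "n \<ge> 1" and r: "64 * B * (real n)\<^sup>2 * r \<le> 1"
    and near: "\<And>j. norm ((f ^^ (p * j)) w - a i) \<le> r"
    and per: "(f ^^ (p * n)) w = w" and k: "k \<le> n" "(f ^^ (p * k)) w \<noteq> w"
  shows "norm (w - a i) / (8 * n) \<le> norm ((f ^^ (p * k)) w - w)"
proof (rule ccontr)
  assume "\<not> ?thesis"
  then have small: "norm ((f ^^ (p * k)) w - w) < norm (w - a i) / (8 * n)" by simp
  define h where "h = f ^^ (p * k)"
  define u where "u = norm (w - a i)"
  have r0: "r \<ge> 0" using near[of 0] norm_ge_zero order_trans by blast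
  have u0: "u > 0" using small n norm_ge_zero[of "(f ^^ (p * k)) w - w"] unfolding u_def
    by (smt (verit) divide_nonpos_nonneg of_nat_0_le_iff)
  have nn: "real n \<le> (real n)\<^sup>2" using n by (simp add: power2_eq_square)
  have "4 * B * n * r \<le> 64 * B * (real n)\<^sup>2 * r"
    using nn B r0 by (intro mult_right_mono mult_mono) auto
  then have r1: "4 * B * n * r \<le> 1" using r by linarith
  have r2: "4 * B * k * r \<le> 1 / (16 * n)"
  proof -
    have "4 * B * k * r \<le> 4 * B * n * r" using k B r0 by (intro mult_right_mono mult_left_mono) auto
    then have "16 * n * (4 * B * k * r) \<le> 16 * n * (4 * B * n * r)" by (intro mult_left_mono) auto
    also have "\<dots> \<le> 1" using r by (simp add: power2_eq_square mult_ac)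
    finally show ?thesis using n by (subst pos_le_divide_eq) (auto simp: mult_ac)
  qed
  have nD: "norm (D (p * k) x - lam ^ k) \<le> 1 / (16 * n)" if "norm (x - a i) \<le> r" for x
    using near_D[OF n k(1) r1 that] r2 by linarith
  have h_lin: "norm ((h x - lam ^ k * x) - (h y - lam ^ k * y)) \<le> 1 / (16 * n) * norm (x - y)"
    if "norm (x - a i) \<le> r" "norm (y - a i) \<le> r" for x y
  proof (rule field_differentiable_bound[of "cball (a i) r" "\<lambda>x. h x - lam ^ k * x" "\<lambda>x. D (p * k) x - lam ^ k"])
    show "((\<lambda>x. h x - lam ^ k * x) has_field_derivative D (p * k) z - lam ^ k) (at z within cball (a i) r)" for z
      unfolding h_def by (auto intro!: derivative_eq_intros has_field_derivative_at_within[OF has_deriv_iter])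
    show "norm (D (p * k) z - lam ^ k) \<le> 1 / (16 * n)" if "z \<in> cball (a i) r" for z
      using nD[of z] that by (simp add: dist_norm norm_minus_commute)
  qed (use that in \<open>auto simp: dist_norm norm_minus_commute\<close>)
  have ha: "h (a i) = a i" by (simp add: h_def iter_a_period)
  \<comment> \<open>Testing the linear approximation on the pair \<open>w\<close>,
    \<open>a i\<close> recovers \<open>lam ^ k\<close>, because \<open>h\<close> fixes
    \<open>a i\<close> and hardly moves \<open>w\<close>.\<close>
  have lamk: "norm (lam ^ k - 1) \<le> 3 / (16 * n)"
  proof -
    have "(lam ^ k - 1) * (w - a i) = (h w - w) - ((h w - lam ^ k * w) - (h (a i) - lam ^ k * a i))"
      by (simp add: ha algebra_simps)
    then have "norm (lam ^ k - 1) * u \<le> norm (h w - w) + norm ((h w - lam ^ k * w) - (h (a i) - lam ^ k * a i))"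
      unfolding u_def by (metis norm_mult norm_triangle_ineq4)
    also have "\<dots> \<le> u / (8 * n) + 1 / (16 * n) * u"
      using small h_lin[of w "a i"] near[of 0] r0 unfolding h_def u_def by (intro add_mono) auto
    also have "\<dots> = 3 / (16 * n) * u" using n by (simp add: field_simps)
    finally show ?thesis using u0 by (rule mult_right_le_imp_le)
  qed
  define d where "d = (\<lambda>x. h x - x)"
  have d_lip: "norm (d x - d y) \<le> 1 / (4 * n) * norm (x - y)"
    if "norm (x - a i) \<le> r" "norm (y - a i) \<le> r" for x y
  proof -
    have "d x - d y = ((h x - lam ^ k * x) - (h y - lam ^ k * y)) + (lam ^ k - 1) * (x - y)"
      by (simp add: d_def algebra_simps)
    then have "norm (d x - d y) \<le> norm ((h x - lam ^ k * x) - (h y - lam ^ k * y)) + norm ((lam ^ k - 1) * (x - y))"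
      by (metis norm_triangle_ineq)
    also have "\<dots> \<le> 1 / (16 * n) * norm (x - y) + 3 / (16 * n) * norm (x - y)"
      unfolding norm_mult by (intro add_mono h_lin that mult_right_mono lamk) auto
    also have "\<dots> = 1 / (4 * n) * norm (x - y)" using n by (simp add: field_simps)
    finally show ?thesis .
  qed
  define x where "x = (\<lambda>j. (f ^^ (p * (k * j))) w)"
  have xr: "norm (x j - a i) \<le> r" for j using near by (simp add: x_def)
  have xS: "x (Suc j) = h (x j)" for j
    unfolding x_def h_def iter_add[symmetric] by (simp add: algebra_simps)
  have dj: "d (x j) = x (Suc j) - x j" for j by (simp add: d_def xS)
  define e where "e = norm (d (x 0))"
  \<comment> \<open>Inductively the increments stay below \<open>2 * e\<close>, so by
    \<open>d_lip\<close> each step changes the increment by at most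
    \<open>e / (2 * n)\<close>.\<close>
  have step: "norm (d (x j) - d (x 0)) \<le> j / (2 * n) * e" if "j \<le> n" for j
    using that
  proof (induction j)
    case 0 then show ?case by simp
  next
    case (Suc j)
    have IH: "norm (d (x j) - d (x 0)) \<le> j / (2 * n) * e" using Suc by simp
    also have "\<dots> \<le> 1 * e" using Suc.prems by (intro mult_right_mono) (auto simp: e_def field_simps)
    finally have "norm (d (x j)) \<le> 2 * e"
      using norm_triangle_ineq2[of "d (x j)" "d (x 0)"] by (simp add: e_def)
    then have "1 / (4 * n) * norm (d (x j)) \<le> 1 / (4 * n) * (2 * e)" by (intro mult_left_mono) auto
    moreover have "norm (d (x (Suc j)) - d (x j)) \<le> 1 / (4 * n) * norm (d (x j))"
      using d_lip[OF xr xr, of "Suc j" j] by (simp add: dj)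
    moreover have "norm (d (x (Suc j)) - d (x 0)) \<le> norm (d (x (Suc j)) - d (x j)) + norm (d (x j) - d (x 0))"
      using norm_triangle_ineq[of "d (x (Suc j)) - d (x j)" "d (x j) - d (x 0)"] by simp
    moreover have "1 / (4 * n) * (2 * e) + j / (2 * n) * e = Suc j / (2 * n) * e"
      using n by (simp add: field_simps)
    ultimately show ?case using IH by linarith
  qed
  \<comment> \<open>The orbit closes up after \<open>n\<close> steps, so the increments add up to
    zero; but each of them is within \<open>e / 2\<close> of the first, which forces
    \<open>e = 0\<close>.\<close>
  have "(\<Sum>j<n. d (x j)) = x n - x 0"
    unfolding dj by (rule sum_lessThan_telescope)
  also have "x n = x 0"
    using funpow_fixed_mult[OF per, of k] by (simp add: x_def mult_ac)
  finally have s0: "(\<Sum>j<n. d (x j)) = 0" by simp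
  have "(\<Sum>j<n. d (x j) - d (x 0)) = - (of_nat n * d (x 0))"
    using s0 by (simp add: sum_subtractf)
  then have "n * e = norm (\<Sum>j<n. d (x j) - d (x 0))" by (simp add: e_def norm_mult)
  also have "\<dots> \<le> (\<Sum>j<n. e / 2)"
  proof (rule sum_norm_le)
    fix j assume "j \<in> {..<n}"
    then have "norm (d (x j) - d (x 0)) \<le> j / (2 * n) * e" "j / (2 * n) \<le> 1 / 2"
      using step[of j] by (auto simp: field_simps)
    moreover from this(2) have "j / (2 * n) * e \<le> 1 / 2 * e"
      by (rule mult_right_mono) (simp add: e_def)
    ultimately show "norm (d (x j) - d (x 0)) \<le> e / 2" by linarith
  qed
  finally have "e \<le> 0" using n by simp
  then have "d (x 0) = 0" by (simp add: e_def)
  then show False using k(2) by (simp add: d_def x_def h_def)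
qed

definition displacement :: "nat \<Rightarrow> complex \<Rightarrow> complex" where
  "displacement n x = (f ^^ (p * n)) x - x"

lemma holomorphic_displacement: "displacement n holomorphic_on UNIV"
  unfolding displacement_def[abs_def] by (intro holomorphic_intros holomorphic_iter)

text \<open>Within \<open>1 / (4 * B * n)\<close> of \<open>a i\<close> the returns at most double
  the distance, so the displacement is at most 1 there. The zeros lie within half of this radius,
  and removing one costs the inverse of the remaining half, \<open>8 * B * n\<close>.\<close>

lemma displacement_zeros:
  fixes n :: nat
  assumes n: "n \<ge> 1" and S: "finite S" "\<And>\<zeta>. \<zeta> \<in> S \<Longrightarrow> displacement n \<zeta> = 0 \<and> norm (\<zeta> - a i) \<le> r"
    and r: "8 * B * n * r \<le> 1"
  obtains H where "H holomorphic_on UNIV" "\<And>z. displacement n z = (\<Prod>\<zeta>\<in>S. z - \<zeta>) * H z"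
    "\<And>z. norm (z - a i) \<le> 1 / (4 * B * n) \<Longrightarrow> norm (H z) \<le> (8 * B * n) ^ card S"
proof -
  define \<rho> where "\<rho> = 1 / (4 * B * n)"
  have \<rho>: "\<rho> \<le> 1/4" "\<rho> > 0" using quarter_bound[OF n] B n by (auto simp: \<rho>_def)
  have r\<rho>: "r \<le> \<rho> / 2" using r n B by (simp add: \<rho>_def field_simps)
  have bd: "norm (displacement n z) \<le> 1" if "norm (z - a i) \<le> \<rho>" for z
  proof -
    have "displacement n z = ((f ^^ (p * n)) z - a i) - (z - a i)" by (simp add: displacement_def)
    then have "norm (displacement n z) \<le> norm ((f ^^ (p * n)) z - a i) + norm (z - a i)"
      by (metis norm_triangle_ineq4)
    also have "norm ((f ^^ (p * n)) z - a i) \<le> 2 * norm (z - a i)"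
      using near_iter_period_double[of n n z i] n that by (simp add: \<rho>_def)
    finally show ?thesis using that \<rho> by linarith
  qed
  have "\<exists>H. H holomorphic_on UNIV \<and> (\<forall>z. displacement n z = (\<Prod>\<zeta>\<in>S. z - \<zeta>) * H z) \<and>
           (\<forall>z. norm (z - a i) \<le> \<rho> \<longrightarrow> norm (H z) \<le> 1 / (\<rho> - \<rho>/2) ^ card S)"
  proof (rule divide_out_zeros[OF S(1) holomorphic_displacement])
    show "S \<subseteq> cball (a i) (\<rho>/2)"
      using S(2) r\<rho> by (force simp: dist_norm norm_minus_commute)
  qed (use S bd \<rho> in auto)
  then obtain H where H: "H holomorphic_on UNIV" "\<And>z. displacement n z = (\<Prod>\<zeta>\<in>S. z - \<zeta>) * H z"
    "\<And>z. norm (z - a i) \<le> \<rho> \<Longrightarrow> norm (H z) \<le> 1 / (\<rho> - \<rho>/2) ^ card S" by blast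
  have "1 / (\<rho> - \<rho>/2) ^ m = (8 * B * n) ^ m" for m
    by (simp add: \<rho>_def power_divide field_simps)
  then show ?thesis using that[OF H(1,2)] H(3) by (simp add: \<rho>_def)
qed

end

section \<open>Partial fractions with simple poles\<close>

text \<open>The numerator of \<open>\<Sum>k\<in>I. b k / (z - y k)\<close> over the common
  denominator. Maximum principles apply to it, since it has no poles.\<close>

definition partial_fraction_num :: "'i set \<Rightarrow> ('i \<Rightarrow> complex) \<Rightarrow> ('i \<Rightarrow> complex) \<Rightarrow> complex poly" where
  "partial_fraction_num I b y = (\<Sum>k\<in>I. smult (b k) (\<Prod>j\<in>I - {k}. [:- y j, 1:]))"

lemma poly_partial_fraction_num:
  "poly (partial_fraction_num I b y) z = (\<Sum>k\<in>I. b k * (\<Prod>j\<in>I - {k}. z - y j))"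
  by (simp add: partial_fraction_num_def poly_sum poly_prod)

lemma degree_partial_fraction_num:
  assumes "finite I"
  shows "degree (partial_fraction_num I b y) \<le> card I"
  unfolding partial_fraction_num_def
proof (rule degree_sum_le[OF assms])
  fix k assume "k \<in> I"
  have "degree (smult (b k) (\<Prod>j\<in>I - {k}. [:- y j, 1:])) \<le> degree (\<Prod>j\<in>I - {k}. [:- y j, 1:])"
    by (rule degree_smult_le)
  also have "\<dots> \<le> (\<Sum>j\<in>I - {k}. degree [:- y j, 1:])"
    using degree_prod_sum_le[of "I - {k}" "\<lambda>j. [:- y j, 1:]"] assms by simp
  also have "\<dots> \<le> card I" using assms by (simp add: card_Diff_subset_Int)
  finally show "degree (smult (b k) (\<Prod>j\<in>I - {k}. [:- y j, 1:])) \<le> card I" .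
qed

lemma partial_fraction_eq:
  assumes "finite I" "\<And>k. k \<in> I \<Longrightarrow> z \<noteq> y k"
  shows "(\<Sum>k\<in>I. b k / (z - y k)) = poly (partial_fraction_num I b y) z / (\<Prod>k\<in>I. z - y k)"
  unfolding poly_partial_fraction_num sum_divide_distrib
proof (rule sum.cong)
  fix k assume k: "k \<in> I"
  have "(\<Prod>j\<in>I - {k}. z - y j) \<noteq> 0" using assms by auto
  moreover have "z - y k \<noteq> 0" using assms(2)[OF k] by simp
  ultimately show "b k / (z - y k) = b k * (\<Prod>j\<in>I - {k}. z - y j) / (\<Prod>k\<in>I. z - y k)"
    unfolding prod.remove[OF assms(1) k] by (simp add: divide_simps)
qed simp

text \<open>At \<open>y k\<close> all other summands have a vanishing factor. This recovers the
  coefficients from the size of the numerator.\<close>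

lemma partial_fraction_residue:
  assumes "finite I" "k \<in> I"
  shows "poly (partial_fraction_num I b y) (y k) = b k * (\<Prod>j\<in>I - {k}. y k - y j)"
proof -
  have "(\<Sum>l\<in>I - {k}. b l * (\<Prod>j\<in>I - {l}. y k - y j)) = 0"
  proof (rule sum.neutral, rule ballI)
    fix l assume "l \<in> I - {k}"
    then have "k \<in> I - {l}" using assms by auto
    then have "(\<Prod>j\<in>I - {l}. y k - y j) = 0" using assms by (intro prod_zero) auto
    then show "b l * (\<Prod>j\<in>I - {l}. y k - y j) = 0" by simp
  qed
  then show ?thesis unfolding poly_partial_fraction_num sum.remove[OF assms] by simp
qed

lemma prod_ge_power:
  fixes g :: "'i \<Rightarrow> real"
  assumes "\<And>k. k \<in> I \<Longrightarrow> g k \<ge> t" "t \<ge> 0"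
  shows "(\<Prod>k\<in>I. g k) \<ge> t ^ card I"
  using prod_mono[of I "\<lambda>_. t" g] assms by simp

lemma prod_le_power_card:
  fixes g :: "'i \<Rightarrow> real"
  assumes "\<And>k. k \<in> I \<Longrightarrow> 0 \<le> g k \<and> g k \<le> t"
  shows "(\<Prod>k\<in>I. g k) \<le> t ^ card I"
  using prod_mono[of I g "\<lambda>_. t"] assms by simp

context quadratic_cycle begin

section \<open>Multipliers and the push-forward of simple poles\<close>

text \<open>Written as \<open>(z - x) * K z\<close>, the displacement has derivative
  \<open>K x\<close> at \<open>x\<close>, and \<open>K x\<close> contains the distances from
  \<open>x\<close> to all other zeros. Many close zeros thus force the multiplier towards 1.\<close>

lemma displacement_deriv_bound:
  fixes n :: nat
  assumes n: "n \<ge> 1" and S: "finite S" "\<And>\<zeta>. \<zeta> \<in> S \<Longrightarrow> displacement n \<zeta> = 0 \<and> norm (\<zeta> - a i) \<le> r"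
    and r: "8 * B * n * r \<le> 1" and x: "x \<in> S"
  shows "norm (D (p * n) x - 1) \<le> (\<Prod>\<zeta>\<in>S - {x}. norm (x - \<zeta>)) * (8 * B * n) ^ card S"
proof -
  obtain H where H: "H holomorphic_on UNIV" "\<And>z. displacement n z = (\<Prod>\<zeta>\<in>S. z - \<zeta>) * H z"
    "\<And>z. norm (z - a i) \<le> 1 / (4 * B * n) \<Longrightarrow> norm (H z) \<le> (8 * B * n) ^ card S"
    using displacement_zeros[OF n S r] by blast
  define K where "K = (\<lambda>z. (\<Prod>\<zeta>\<in>S - {x}. z - \<zeta>) * H z)"
  have "K holomorphic_on UNIV" unfolding K_def using H(1) by (intro holomorphic_intros)
  then have "(K has_field_derivative deriv K x) (at x)" by (simp add: holomorphic_derivI)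
  then have "((\<lambda>z. (z - x) * K z) has_field_derivative K x) (at x)"
    by (auto intro!: derivative_eq_intros)
  moreover have "(\<lambda>z. (z - x) * K z) = displacement n"
    unfolding K_def H(2) fun_eq_iff prod.remove[OF S(1) x] by (simp add: mult_ac H(2) prod.remove[OF S(1) x])
  moreover have "(displacement n has_field_derivative D (p * n) x - 1) (at x)"
    unfolding displacement_def[abs_def] by (auto intro!: derivative_eq_intros has_deriv_iter)
  ultimately have "D (p * n) x - 1 = K x" using DERIV_unique by metis
  moreover have "norm (x - a i) \<le> 1 / (4 * B * n)"
  proof -
    have "norm (x - a i) * (4 * B * n) \<le> r * (4 * B * n)" using S(2)[OF x] B by (intro mult_right_mono) auto
    moreover have "0 \<le> r * (4 * B * n)"
      using S(2)[OF x] B order_trans[OF norm_ge_zero] by (intro mult_nonneg_nonneg) auto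
    ultimately have "norm (x - a i) * (4 * B * n) \<le> 1" using r by (simp add: mult_ac)
    then show ?thesis using n B by (subst pos_le_divide_eq) auto
  qed
  then have "norm (H x) \<le> (8 * B * n) ^ card S" by (rule H(3))
  ultimately show ?thesis
    unfolding K_def by (simp add: norm_mult prod_norm[symmetric] mult_left_mono prod_nonneg)
qed

text \<open>The coefficients satisfy
  \<open>\<beta> k / (2 * (f ^^ k) x) = \<kappa> * \<beta> (Suc k)\<close>: a pole moved one step
  along the orbit arrives with \<open>\<kappa>\<close> times the coefficient already there. Only the
  step that closes the orbit leaves a mismatch, the last term.\<close>

lemma cycle_push_sum:
  fixes A :: complex
  assumes "(f ^^ m) x = x" "\<kappa> \<noteq> 0"
  defines "\<beta> \<equiv> \<lambda>k. A / (\<kappa> ^ k * D k x)"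
  shows "(\<Sum>k<m. \<beta> k / (2 * (f ^^ k) x) / (z - f ((f ^^ k) x)))
           = \<kappa> * (\<Sum>k<m. \<beta> k / (z - (f ^^ k) x)) + \<kappa> * (\<beta> m - \<beta> 0) / (z - x)"
proof -
  have "\<beta> k / (2 * (f ^^ k) x) = \<kappa> * \<beta> (Suc k)" for k
    using assms(2) by (simp add: \<beta>_def D_def mult_ac)
  then have "(\<Sum>k<m. \<beta> k / (2 * (f ^^ k) x) / (z - f ((f ^^ k) x)))
      = \<kappa> * (\<Sum>k<m. \<beta> (Suc k) / (z - (f ^^ Suc k) x))"
    by (simp add: sum_distrib_left)
  also have "(\<Sum>k<m. \<beta> (Suc k) / (z - (f ^^ Suc k) x)) = (\<Sum>k<m. \<beta> k / (z - (f ^^ k) x)) + \<beta> m / (z - x) - \<beta> 0 / (z - x)"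
    using sum.lessThan_Suc_shift[of "\<lambda>k. \<beta> k / (z - (f ^^ k) x)" m] assms(1)
    by (simp add: algebra_simps)
  finally show ?thesis by (simp add: algebra_simps diff_divide_distrib)
qed

text \<open>The push-forward of a simple pole: \<open>v\<close> and \<open>- v\<close> are the
  preimages of \<open>f v\<close>, and \<open>4 * v\<^sup>2\<close> is the squared derivative at
  both. After division by it the term \<open>2 / y\<close> becomes the pole at the critical value,
  since \<open>v\<^sup>2 = f v - c\<close>.\<close>

lemma symmetrized_fraction:
  assumes "y \<noteq> 0" "v \<noteq> y" "- v \<noteq> y"
  shows "1 / (v - y) + 1 / (- v - y) = 4 * v\<^sup>2 * (1 / (2 * y) / (f v - f y)) - 2 / (y :: complex)"
proof -
  have "v\<^sup>2 - y\<^sup>2 \<noteq> 0" using assms by (auto simp: power2_eq_iff)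
  moreover have "v - y \<noteq> 0" "- v - y \<noteq> 0" "v + y \<noteq> 0" using assms by (auto simp: add_eq_0_iff)
  moreover have "f v - f y = v\<^sup>2 - y\<^sup>2" by (simp add: f_eq)
  moreover have "1 / (v - y) + 1 / (- v - y) = 2 * y / (v\<^sup>2 - y\<^sup>2)"
    using calculation by (simp add: divide_simps power2_eq_square) (simp add: algebra_simps)
  moreover have "4 * v\<^sup>2 * (1 / (2 * y) / (v\<^sup>2 - y\<^sup>2)) - 2 / y = 2 * y / (v\<^sup>2 - y\<^sup>2)"
    using calculation assms(1) by (simp add: divide_simps) (simp add: power2_eq_square algebra_simps)
  ultimately show ?thesis by simp
qed

definition cyc :: "complex set" where "cyc = a ` {..<p}"

text \<open>The maximal distance to the cycle along the first \<open>m\<close> iterates. If \<open>m = p * n\<close>, then it increases from \<open>z\<close> to \<open>f z\<close>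
  by at most \<open>norm (displacement n z)\<close>, so it replaces a linearizing coordinate.\<close>

primrec drift :: "nat \<Rightarrow> complex \<Rightarrow> real" where
  "drift 0 z = 0"
| "drift (Suc m) z = max (drift m z) (infdist ((f ^^ m) z) cyc)"

lemma cyc_ne: "cyc \<noteq> {}" and finite_cyc: "finite cyc" and a_in_cyc: "a i \<in> cyc"
  using p_pos a_mod[of i] by (auto simp: cyc_def lessThan_empty_iff intro!: image_eqI[of "a i" a "i mod p"])

lemma nearest_cyc: obtains i where "i < p" "infdist z cyc = norm (z - a i)"
proof -
  obtain x where "x \<in> cyc" "infdist z cyc = dist z x"
    using infdist_attains_inf[of cyc z] finite_cyc cyc_ne finite_imp_closed by auto
  then show ?thesis using that by (auto simp: cyc_def dist_norm)
qed

lemma infdist_cyc_le: "infdist z cyc \<le> norm (z - a i)"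
  using infdist_le[OF a_in_cyc, of z i] by (simp add: dist_norm)

lemma drift_ge: "k < m \<Longrightarrow> infdist ((f ^^ k) z) cyc \<le> drift m z"
  by (induction m) (auto simp: less_Suc_eq)

lemma drift_gtD: "drift m z > s \<Longrightarrow> s \<ge> 0 \<Longrightarrow> \<exists>k<m. infdist ((f ^^ k) z) cyc > s"
  by (induction m) (auto simp: less_Suc_eq max_def split: if_splits)

text \<open>The first \<open>m\<close> distances for \<open>f z\<close> are those for
  \<open>z\<close> without the initial one and with the one at time \<open>m\<close> added.\<close>

lemma drift_shift: "drift m (f z) \<le> max (drift m z) (infdist ((f ^^ m) z) cyc)"
  by (induction m) (auto simp: funpow_swap1)

lemma continuous_drift: "continuous_on UNIV (drift m)"
proof (induction m)
  case 0 then show ?case by simp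
next
  case (Suc m)
  have "continuous_on UNIV (\<lambda>z. infdist ((f ^^ m) z) cyc)"
    by (intro continuous_on_infdist continuous_iter)
  then show ?case using Suc by (auto intro: continuous_on_max)
qed

end

section \<open>Two small cycles\<close>

text \<open>The situation that cannot occur for very small \<open>r\<close>. Both orbits are started
  in phase with the cycle, so that iterate \<open>k\<close> follows \<open>a k\<close>. The
  hypothesis \<open>small\<close> keeps all radii of order \<open>L * r\<close> inside the discs of
  radius \<open>1 / (4 * B * n)\<close>, where the returns are under control.\<close>

locale small_cycles = quadratic_cycle +
  fixes n :: nat and r :: real and w w' :: complex
  assumes n2: "n \<ge> 2" and r_pos: "r > 0"
    and small: "64 * B * L * (real n)\<^sup>2 * r \<le> \<sigma>"
    and min_per: "minimal_period f (p * n) w" "minimal_period f (p * n) w'"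
    and shadow: "\<And>k. norm ((f ^^ k) w - a k) < r" "\<And>k. norm ((f ^^ k) w' - a k) < r"
    and disjoint: "\<And>j k. (f ^^ j) w \<noteq> (f ^^ k) w'"
begin

lemma n1: "n \<ge> 1" using n2 by simp

lemma nR: "real n \<ge> 2" using n2 by simp

lemma small_B: "64 * B * (real n)\<^sup>2 * r \<le> 1"
proof -
  have "64 * B * (real n)\<^sup>2 * r * 1 \<le> 64 * B * (real n)\<^sup>2 * r * L"
    using B L r_pos by (intro mult_left_mono) auto
  then show ?thesis using small sigma by (simp add: mult_ac)
qed

lemma small_n: "64 * B * L * n * r \<le> \<sigma>"
proof -
  have "64 * B * L * r * real n \<le> 64 * B * L * r * (real n)\<^sup>2"
    using B L r_pos nR by (intro mult_left_mono) (auto simp: power2_eq_square)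
  then show ?thesis using small by (simp add: mult_ac)
qed

lemma small_Bn: "64 * B * n * r \<le> 1"
proof -
  have "64 * B * n * r * 1 \<le> 64 * B * n * r * L"
    using B L r_pos by (intro mult_left_mono) auto
  then show ?thesis using small_n sigma by (simp add: mult_ac)
qed

lemma cutoff_radius_le: "16 * L * r \<le> 1 / (4 * B * n)"
proof -
  have "16 * L * r * (4 * B * n) \<le> 1" using small_n sigma by (simp add: mult_ac)
  then show ?thesis using B nR by (subst pos_le_divide_eq) auto
qed

lemma r_le_Lr: "r \<le> L * r" using L r_pos by simp

lemma cutoff_radius_small: "16 * L * r \<le> \<sigma> / 4" "16 * L * r \<le> 1"
proof -
  have "1 * 1 \<le> B * real n" using B nR by (intro mult_mono) auto
  then have "64 * L * r * 1 \<le> 64 * L * r * (B * n)"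
    using L r_pos by (intro mult_left_mono) auto
  then show "16 * L * r \<le> \<sigma> / 4" "16 * L * r \<le> 1" using small_n sigma by (simp_all add: mult_ac)
qed

lemma four_r_le: "4 * r \<le> 1 / (4 * B * n)"
  using cutoff_radius_le r_le_Lr r_pos by linarith

lemma per: "(f ^^ (p * n)) w = w" "(f ^^ (p * n)) w' = w'"
  using min_per by (auto simp: minimal_period_def)

section \<open>Zeros of the displacement and multipliers close to 1\<close>

definition strand :: "complex \<Rightarrow> nat \<Rightarrow> complex set" where
  "strand x i = (\<lambda>j. (f ^^ (i + p * j)) x) ` {..<n}"

lemma index_lt: "i < p \<Longrightarrow> j < n \<Longrightarrow> i + p * j < p * n"
proof -
  assume "i < p" "j < n"
  then have "i + p * j < p * Suc j" by simp
  also have "\<dots> \<le> p * n" using \<open>j < n\<close> by (intro mult_le_mono2) simp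
  finally show ?thesis .
qed

lemma card_strand:
  assumes "minimal_period f (p * n) x" "i < p"
  shows "card (strand x i) = n"
proof -
  have "inj_on (\<lambda>j. (f ^^ (i + p * j)) x) {..<n}"
  proof (rule inj_onI)
    fix j k assume "j \<in> {..<n}" "k \<in> {..<n}" "(f ^^ (i + p * j)) x = (f ^^ (i + p * k)) x"
    then have "i + p * j = i + p * k"
      using inj_onD[OF minimal_period_inj[OF assms(1)], of "i + p * j" "i + p * k"] index_lt[OF assms(2)] by simp
    then show "j = k" using p_pos by simp
  qed
  then show ?thesis by (simp add: strand_def card_image)
qed

text \<open>Meeting the cycle would give \<open>x\<close> the period \<open>p\<close>, which is
  smaller than \<open>p * n\<close> because \<open>n \<ge> 2\<close>.\<close>

lemma orbit_avoids_cycle: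
  assumes "minimal_period f (p * n) x"
  shows "(f ^^ k) x \<noteq> a i"
proof
  assume "(f ^^ k) x = a i"
  then have "(f ^^ p) ((f ^^ k) x) = (f ^^ k) x" using iter_a_period[of 1 i] by simp
  then have "(f ^^ p) x = x"
    using funpow_period_shift[of "p * n" f x p k] assms by (simp add: minimal_period_def)
  moreover have "p < p * n" using p_pos n2 by simp
  ultimately show False using assms p_pos by (auto simp: minimal_period_def)
qed

definition zeros :: "nat \<Rightarrow> complex set" where
  "zeros i = insert (a i) (strand w i \<union> strand w' i)"

lemma finite_zeros [simp]: "finite (zeros i)" "finite (strand x i)"
  by (simp_all add: zeros_def strand_def)

lemma strand_disjoint: "strand w i \<inter> strand w' i = {}"
  using disjoint by (auto simp: strand_def)

lemma a_notin_strand: "a i \<notin> strand w j" "a i \<notin> strand w' j"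
  using orbit_avoids_cycle[OF min_per(1)] orbit_avoids_cycle[OF min_per(2)] by (auto simp: strand_def) metis+

lemma card_zeros: "i < p \<Longrightarrow> card (zeros i) = 2 * n + 1"
  using card_strand[OF min_per(1)] card_strand[OF min_per(2)] strand_disjoint a_notin_strand
  by (simp add: zeros_def card_Un_disjoint)

lemma period_strand: "(f ^^ m) x = x \<Longrightarrow> (f ^^ m) ((f ^^ k) x) = (f ^^ k) x"
  by (metis iter_add add.commute)

lemma zerosD:
  assumes "\<zeta> \<in> zeros i"
  shows "displacement n \<zeta> = 0 \<and> norm (\<zeta> - a i) \<le> r"
proof -
  have "norm ((f ^^ (i + p * j)) w - a i) \<le> r" "norm ((f ^^ (i + p * j)) w' - a i) \<le> r" for j
    using shadow[of "i + p * j"] by (auto simp: a_add_period less_imp_le)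
  then show ?thesis
    using assms per r_pos iter_a_period[of n i]
    by (auto simp: zeros_def strand_def displacement_def period_strand)
qed

lemma eight_Bnr: "8 * B * n * r \<le> 1"
proof -
  have "0 \<le> B * n * r" using B r_pos by simp
  then show ?thesis using small_Bn by linarith
qed

text \<open>Each of the \<open>2 * n + 1\<close> zeros contributes a distance of at most
  \<open>17 * L * r\<close> and a factor \<open>8 * B * n\<close> from dividing it out;
  \<open>136\<close> is \<open>17 * 8\<close>.\<close>

lemma displacement_bound:
  assumes "i < p" "norm (v - a i) \<le> 16 * L * r"
  shows "norm (displacement n v) \<le> (136 * B * L * n * r) ^ (2 * n + 1)"
proof -
  obtain H where H: "\<And>z. displacement n z = (\<Prod>\<zeta>\<in>zeros i. z - \<zeta>) * H z"
    "\<And>z. norm (z - a i) \<le> 1 / (4 * B * n) \<Longrightarrow> norm (H z) \<le> (8 * B * n) ^ card (zeros i)"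
    using displacement_zeros[OF n1 finite_zeros(1) zerosD eight_Bnr, of i] by blast
  have "norm (H v) \<le> (8 * B * n) ^ card (zeros i)" using H(2)[of v] assms cutoff_radius_le by linarith
  moreover have "(\<Prod>\<zeta>\<in>zeros i. norm (v - \<zeta>)) \<le> (17 * L * r) ^ card (zeros i)"
  proof (rule prod_le_power_card)
    fix \<zeta> assume "\<zeta> \<in> zeros i"
    then have "norm (\<zeta> - a i) \<le> r" using zerosD by blast
    then show "0 \<le> norm (v - \<zeta>) \<and> norm (v - \<zeta>) \<le> 17 * L * r"
      using norm_triangle_ineq4[of "v - a i" "\<zeta> - a i"] assms(2) r_le_Lr by simp
  qed
  ultimately have "norm (displacement n v) \<le> (17 * L * r) ^ card (zeros i) * (8 * B * n) ^ card (zeros i)"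
    unfolding H(1) norm_mult prod_norm[symmetric] using L r_pos by (intro mult_mono) auto
  also have "\<dots> = (136 * B * L * n * r) ^ (2 * n + 1)"
    unfolding card_zeros[OF assms(1)] power_mult_distrib[symmetric] by (simp add: mult_ac)
  finally show ?thesis .
qed

text \<open>\<open>u\<close> may be far smaller than \<open>r\<close>, so it is kept as a scale of
  its own.\<close>

definition u :: real where "u = norm (w - a 0)"

lemma u_pos: "u > 0" using orbit_avoids_cycle[OF min_per(1), of 0 0] by (simp add: u_def)

lemma u_le: "u \<le> r" using shadow(1)[of 0] by (simp add: u_def)

lemma strand_u: "\<zeta> \<in> strand w 0 \<Longrightarrow> norm (\<zeta> - a 0) \<le> 2 * u"
proof -
  assume "\<zeta> \<in> strand w 0"
  then obtain j where "j < n" "\<zeta> = (f ^^ (p * j)) w" by (auto simp: strand_def)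
  then show ?thesis
    using near_iter_period_double[of n j w 0] n1 u_le four_r_le r_pos by (simp add: u_def)
qed

text \<open>A common bound for the derivative of the displacement at \<open>a 0\<close> and at
  \<open>w\<close>: in both cases \<open>n\<close> of the other zeros are at scale \<open>u\<close>
  and \<open>n\<close> at scale \<open>r\<close>.\<close>

definition T :: real where "T = (3 * u) ^ n * (2 * r) ^ n * (8 * B * n) ^ (2 * n + 1)"

lemma w_in: "w \<in> strand w 0" 
  using n2 by (auto simp: strand_def intro!: image_eqI[of _ _ 0])

lemma lam_power_bound: "norm (lam ^ n - 1) \<le> T"
proof -
  have D: "D (p * k) (a 0) = lam ^ k" for k
  proof (induction k)
    case 0 show ?case by (simp add: D_def)
  next
    case (Suc k)
    have "D p (a 0) = lam" using multiplier by (simp add: a_def)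
    then show ?case using D_add[of p "p * k" "a 0"] Suc iter_a_period[of k 0] by simp
  qed
  have e: "zeros 0 - {a 0} = strand w 0 \<union> strand w' 0" using a_notin_strand by (auto simp: zeros_def)
  have "norm (lam ^ n - 1) \<le> (\<Prod>\<zeta>\<in>zeros 0 - {a 0}. norm (a 0 - \<zeta>)) * (8 * B * n) ^ card (zeros 0)"
    using displacement_deriv_bound[where S = "zeros 0" and i = 0 and x = "a 0", OF n1 finite_zeros(1) zerosD eight_Bnr] D
    by (simp add: zeros_def)
  also have "(\<Prod>\<zeta>\<in>zeros 0 - {a 0}. norm (a 0 - \<zeta>))
      = (\<Prod>\<zeta>\<in>strand w 0. norm (a 0 - \<zeta>)) * (\<Prod>\<zeta>\<in>strand w' 0. norm (a 0 - \<zeta>))"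
    unfolding e by (rule prod.union_disjoint) (use strand_disjoint in auto)
  also have "\<dots> \<le> (3 * u) ^ card (strand w 0) * (2 * r) ^ card (strand w' 0)"
  proof (intro mult_mono prod_le_power_card)
    fix \<zeta> assume "\<zeta> \<in> strand w 0"
    from strand_u[OF this] show "0 \<le> norm (a 0 - \<zeta>) \<and> norm (a 0 - \<zeta>) \<le> 3 * u"
      using u_pos by (simp add: norm_minus_commute)
  next
    fix \<zeta> assume "\<zeta> \<in> strand w' 0"
    then have "norm (\<zeta> - a 0) \<le> r" using zerosD[of \<zeta> 0] by (simp add: zeros_def)
    then show "0 \<le> norm (a 0 - \<zeta>) \<and> norm (a 0 - \<zeta>) \<le> 2 * r"
      using r_pos by (simp add: norm_minus_commute)
  qed (use u_pos in \<open>auto intro!: prod_nonneg\<close>)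
  finally show ?thesis
    using B by (simp add: T_def card_strand[OF min_per(1) p_pos] card_strand[OF min_per(2) p_pos] card_zeros[OF p_pos]
        mult_right_mono)
qed

definition \<rho> :: complex where "\<rho> = D (p * n) w"

text \<open>As seen from \<open>w\<close>, the zeros at scale \<open>u\<close> are
  \<open>a 0\<close> and the other \<open>n - 1\<close> points of its strand.\<close>

lemma rho_bound: "norm (\<rho> - 1) \<le> T"
proof -
  have e: "zeros 0 - {w} = insert (a 0) (strand w 0 - {w}) \<union> strand w' 0"
    using w_in strand_disjoint orbit_avoids_cycle[OF min_per(1), of 0 0] by (auto simp: zeros_def)
  have "norm (\<rho> - 1) \<le> (\<Prod>\<zeta>\<in>zeros 0 - {w}. norm (w - \<zeta>)) * (8 * B * n) ^ card (zeros 0)"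
    using displacement_deriv_bound[where S = "zeros 0" and i = 0 and x = w, OF n1 finite_zeros(1) zerosD eight_Bnr] w_in
    by (simp add: zeros_def \<rho>_def)
  also have "(\<Prod>\<zeta>\<in>zeros 0 - {w}. norm (w - \<zeta>))
      = (\<Prod>\<zeta>\<in>insert (a 0) (strand w 0 - {w}). norm (w - \<zeta>)) * (\<Prod>\<zeta>\<in>strand w' 0. norm (w - \<zeta>))"
    unfolding e by (rule prod.union_disjoint) (use strand_disjoint a_notin_strand in auto)
  also have "\<dots> \<le> (3 * u) ^ card (insert (a 0) (strand w 0 - {w})) * (2 * r) ^ card (strand w' 0)"
  proof (intro mult_mono prod_le_power_card)
    fix \<zeta> assume "\<zeta> \<in> insert (a 0) (strand w 0 - {w})"
    then have "norm (\<zeta> - a 0) \<le> 2 * u" using strand_u u_pos by auto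
    then show "0 \<le> norm (w - \<zeta>) \<and> norm (w - \<zeta>) \<le> 3 * u"
      using norm_triangle_ineq4[of "w - a 0" "\<zeta> - a 0"] by (simp add: u_def)
  next
    fix \<zeta> assume "\<zeta> \<in> strand w' 0"
    then have "norm (\<zeta> - a 0) \<le> r" using zerosD[of \<zeta> 0] by (simp add: zeros_def)
    then show "0 \<le> norm (w - \<zeta>) \<and> norm (w - \<zeta>) \<le> 2 * r"
      using norm_triangle_ineq4[of "w - a 0" "\<zeta> - a 0"] u_le by (simp add: u_def)
  qed (use u_pos in \<open>auto intro!: prod_nonneg\<close>)
  also have "card (insert (a 0) (strand w 0 - {w})) = n"
    using a_notin_strand w_in card_strand[OF min_per(1) p_pos] n2 by (simp add: card_Diff_singleton)
  finally show ?thesis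
    using B by (simp add: T_def card_strand[OF min_per(2) p_pos] card_zeros[OF p_pos]
        mult_right_mono)
qed

lemma rho_large: "norm \<rho> \<ge> 1 / 2"
proof -
  have "norm (D (p * n) w - lam ^ n) \<le> 4 * B * n * r"
    using near_D[of n n r w 0] n1 small_Bn shadow(1)[of 0] B r_pos by (simp add: field_simps)
  moreover have "4 * B * n * r \<le> 1/2" using small_Bn by linarith
  ultimately show ?thesis
    using norm_triangle_ineq2[of "lam ^ n" "\<rho>"] by (simp add: \<rho>_def norm_power lam norm_minus_commute)
qed

text \<open>Bounds the mismatch left when the poles on the orbit of \<open>w\<close> are transported
  once around it.\<close>

lemma multiplier_ratio: "norm (lam ^ n / \<rho> - 1) \<le> 4 * T"
proof -
  have "\<rho> \<noteq> 0" using rho_large by auto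
  then have "norm (lam ^ n / \<rho> - 1) = norm ((lam ^ n - 1) - (\<rho> - 1)) / norm \<rho>"
    by (simp add: norm_divide[symmetric] divide_simps)
  also have "\<dots> \<le> (T + T) / (1/2)"
    using norm_triangle_ineq4[of "lam ^ n - 1" "\<rho> - 1"] lam_power_bound rho_bound rho_large
      order_trans[OF norm_ge_zero rho_bound]
    by (intro frac_le) auto
  finally show ?thesis by simp
qed

section \<open>The rational function and its push-forward\<close>

definition m :: nat where "m = p * n"

text \<open>Any \<open>p\<close>-th root of \<open>1 / lam\<close> serves; since \<open>norm lam = 1\<close>, it has modulus exactly one.\<close>

definition \<kappa> :: complex where "\<kappa> = exp (- (Ln lam / of_nat p))"

lemma kappa_power: "\<kappa> ^ p = inverse lam"
proof -
  have "lam \<noteq> 0" using lam by auto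
  have "\<kappa> ^ p = exp (of_nat p * (- (Ln lam / of_nat p)))" unfolding \<kappa>_def by (rule exp_of_nat_mult[symmetric])
  also have "of_nat p * (- (Ln lam / of_nat p)) = - Ln lam" using p_pos by simp
  finally show ?thesis using \<open>lam \<noteq> 0\<close> by (simp add: exp_minus)
qed

lemma norm_kappa: "norm \<kappa> = 1"
proof -
  have "norm \<kappa> ^ p = 1" using arg_cong[OF kappa_power, of norm] by (simp add: norm_power norm_inverse lam)
  then show ?thesis using p_pos power_eq_imp_eq_base[of "norm \<kappa>" p 1] by simp
qed

lemma kappa_nz: "\<kappa> \<noteq> 0" using norm_kappa by auto

text \<open>Up to sign, the residue at the critical value \<open>c\<close> of the push-forward of
  the normalized poles on the orbit of \<open>x\<close>.\<close>

definition orbit_sum :: "complex \<Rightarrow> nat \<Rightarrow> complex" where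
  "orbit_sum x l = (\<Sum>k<l. 1 / (\<kappa> ^ k * D k x) / (2 * (f ^^ k) x))"

text \<open>\<open>cA\<close> and \<open>cB\<close> weight the poles on the orbit of \<open>w\<close> and on the cycle so that the contributions to the pole
  of the transferred function at the critical value \<open>c\<close> cancel.\<close>

definition degenerate :: bool where
  "degenerate \<longleftrightarrow> orbit_sum w m = 0 \<and> orbit_sum z0 p = 0"

definition cA :: complex where "cA = (if degenerate then 1 else orbit_sum z0 p)"
definition cB :: complex where "cB = (if degenerate then 0 else - orbit_sum w m)"

lemma cA_cB: "cA * orbit_sum w m + cB * orbit_sum z0 p = 0" "cA \<noteq> 0 \<or> cB \<noteq> 0"
  by (auto simp: cA_def cB_def degenerate_def)

text \<open>One index range lists the orbit of \<open>w\<close> and then the cycle, so that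
  \<open>\<phi>\<close> is a single partial fraction. \<open>cls k\<close> is the index of the cycle
  point that the pole \<open>y k\<close> follows.\<close>

definition y :: "nat \<Rightarrow> complex" where "y k = (if k < m then (f ^^ k) w else a (k - m))"
definition b :: "nat \<Rightarrow> complex" where
  "b k = (if k < m then cA / (\<kappa> ^ k * D k w) else cB / (\<kappa> ^ (k - m) * D (k - m) z0))"
definition cls :: "nat \<Rightarrow> nat" where "cls k = (if k < m then k mod p else k - m)"

definition \<phi> :: "complex \<Rightarrow> complex" where "\<phi> z = (\<Sum>k<m + p. b k / (z - y k))"

lemma sum_lessThan_add: "(\<Sum>k<i + j. g k) = (\<Sum>k<i. g k) + (\<Sum>k<j. g (i + k))"
  for g :: "nat \<Rightarrow> 'b::comm_monoid_add"
  by (induction j) (auto simp: add_ac)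

lemma y_near: "k < m + p \<Longrightarrow> cls k < p \<and> norm (y k - a (cls k)) \<le> r"
  using shadow(1)[of k] p_pos r_pos a_mod[of k] by (auto simp: y_def cls_def less_imp_le)

lemma m_pos: "m > 0" using p_pos n2 by (simp add: m_def)

lemma inj_y: "inj_on y {..<m + p}"
proof (rule linorder_inj_onI')
  fix i j assume ij: "i \<in> {..<m + p}" "j \<in> {..<m + p}" "i < j"
  consider "j < m" | "i < m" "\<not> j < m" | "\<not> i < m" by linarith
  then show "y i \<noteq> y j"
  proof cases
    case 1
    then show ?thesis using ij inj_onD[OF minimal_period_inj[OF min_per(1)], of i j] by (auto simp: y_def m_def)
  next
    case 2
    then show ?thesis using orbit_avoids_cycle[OF min_per(1)] by (simp add: y_def)
  next
    case 3
    then have "(i - m) mod p \<noteq> (j - m) mod p" using ij by auto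
    from sep[OF this] show ?thesis using 3 ij sigma by (auto simp: y_def)
  qed
qed

text \<open>At the critical point \<open>D p\<close> vanishes, whereas near the cycle it is within
  \<open>1 / 2\<close> of \<open>lam\<close>, which has modulus 1.\<close>

lemma nonzero_near: assumes "norm (x - a i) \<le> r" shows "x \<noteq> 0"
proof
  assume x: "x = 0"
  have "D p x = 0" unfolding D_def using p_pos x by (intro prod_zero bexI[of _ 0]) auto
  moreover have "r \<le> 1" "B * r \<le> 1 / 2"
  proof -
    show "r \<le> 1" using cutoff_radius_small(2) r_le_Lr r_pos by linarith
    have "B * r * 1 \<le> B * r * n" using B r_pos nR by (intro mult_left_mono) auto
    moreover have "64 * (B * r * n) \<le> 1" using small_Bn by (simp add: mult_ac)
    ultimately show "B * r \<le> 1 / 2" by simp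
  qed
  moreover have "B * norm (x - a i) \<le> B * r" using assms B by (intro mult_left_mono) auto
  ultimately show False using deriv_near[of x i] assms lam by (simp add: norm_minus_commute)
qed

lemma y_nz: "k < m + p \<Longrightarrow> y k \<noteq> 0"
  using y_near nonzero_near by blast

lemma f_maps_poles: assumes "k < m + p" shows "\<exists>j<m + p. f (y k) = y j"
proof (cases "k < m")
  case True
  have "(f ^^ m) w = w" using per(1) by (simp add: m_def)
  then have "f (y k) = y (if Suc k < m then Suc k else 0)"
    using True m_pos by (auto simp: y_def not_less_less_Suc_eq)
       (metis Suc_lessI comp_apply funpow.simps(2))
  then show ?thesis using True m_pos by (intro exI[of _ "if Suc k < m then Suc k else 0"]) auto
next
  case False
  have "f (y k) = a (Suc (k - m))" using False by (simp add: y_def a_def)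
  also have "\<dots> = a (Suc (k - m) mod p)" by (simp add: a_mod)
  also have "\<dots> = y (m + Suc (k - m) mod p)" by (simp add: y_def)
  finally show ?thesis using p_pos by (intro exI[of _ "m + Suc (k - m) mod p"]) auto
qed

lemma y_lo: "k < m \<Longrightarrow> y k = (f ^^ k) w" and y_hi: "y (m + k) = (f ^^ k) z0"
  and b_lo: "k < m \<Longrightarrow> b k = cA / (\<kappa> ^ k * D k w)" and b_hi: "b (m + k) = cB / (\<kappa> ^ k * D k z0)"
  by (simp_all add: y_def b_def a_def)

lemma D_zero: "D 0 x = 1"
  by (simp add: D_def)

lemma sum_poles:
  "(\<Sum>k<m + p. G (b k) (y k)) = (\<Sum>k<m. G (cA / (\<kappa> ^ k * D k w)) ((f ^^ k) w))
      + (\<Sum>k<p. G (cB / (\<kappa> ^ k * D k z0)) ((f ^^ k) z0))" for G :: "complex \<Rightarrow> complex \<Rightarrow> complex"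
proof -
  have "(\<Sum>k<m. G (b k) (y k)) = (\<Sum>k<m. G (cA / (\<kappa> ^ k * D k w)) ((f ^^ k) w))"
    by (rule sum.cong) (simp_all only: lessThan_iff y_lo b_lo)
  then show ?thesis
    by (simp only: sum_lessThan_add[of "\<lambda>k. G (b k) (y k)" m p] y_hi b_hi)
qed

text \<open>The pole at the critical value cancels by the choice of \<open>cA\<close> and
  \<open>cB\<close>. Transport along the two orbits reproduces \<open>\<kappa>\<close> times
  \<open>\<phi>\<close>, except for the closing step on the orbit of \<open>w\<close>.\<close>

lemma phi_push:
  assumes "\<And>k. k < m + p \<Longrightarrow> v \<noteq> y k \<and> - v \<noteq> y k"
  shows "\<phi> v + \<phi> (- v) = 4 * v\<^sup>2 * (\<kappa> * \<phi> (f v) + \<kappa> * (cA * (lam ^ n / \<rho> - 1)) / (f v - w))"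
proof -
  have "\<phi> v + \<phi> (- v) = (\<Sum>k<m + p. b k * (1 / (v - y k) + 1 / (- v - y k)))"
    unfolding \<phi>_def sum.distrib[symmetric] by (simp add: algebra_simps)
  also have "\<dots> = (\<Sum>k<m + p. b k * (4 * v\<^sup>2 * (1 / (2 * y k) / (f v - f (y k))) - 2 / y k))"
    by (rule sum.cong) (use symmetrized_fraction assms y_nz in auto)
  also have "\<dots> = 4 * v\<^sup>2 * (\<Sum>k<m + p. b k / (2 * y k) / (f v - f (y k))) - 4 * (\<Sum>k<m + p. b k / (2 * y k))"
    unfolding sum_distrib_left sum_subtractf[symmetric]
    by (rule sum.cong) (auto simp: right_diff_distrib mult_ac)
  also have "(\<Sum>k<m + p. b k / (2 * y k)) = cA * orbit_sum w m + cB * orbit_sum z0 p"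
    unfolding sum_poles[of "\<lambda>b y. b / (2 * y)"] orbit_sum_def sum_distrib_left by simp
  also have "\<dots> = 0" by (rule cA_cB(1))
  also have "(\<Sum>k<m + p. b k / (2 * y k) / (f v - f (y k)))
      = (\<Sum>k<m. cA / (\<kappa> ^ k * D k w) / (2 * (f ^^ k) w) / (f v - f ((f ^^ k) w)))
      + (\<Sum>k<p. cB / (\<kappa> ^ k * D k z0) / (2 * (f ^^ k) z0) / (f v - f ((f ^^ k) z0)))"
    by (rule sum_poles)
  also have "(\<Sum>k<m. cA / (\<kappa> ^ k * D k w) / (2 * (f ^^ k) w) / (f v - f ((f ^^ k) w)))
      = \<kappa> * (\<Sum>k<m. cA / (\<kappa> ^ k * D k w) / (f v - (f ^^ k) w))
        + \<kappa> * (cA / (\<kappa> ^ m * D m w) - cA / (\<kappa> ^ 0 * D 0 w)) / (f v - w)"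
    using per(1) kappa_nz by (intro cycle_push_sum) (auto simp: m_def)
  also have "(\<Sum>k<p. cB / (\<kappa> ^ k * D k z0) / (2 * (f ^^ k) z0) / (f v - f ((f ^^ k) z0)))
      = \<kappa> * (\<Sum>k<p. cB / (\<kappa> ^ k * D k z0) / (f v - (f ^^ k) z0))
        + \<kappa> * (cB / (\<kappa> ^ p * D p z0) - cB / (\<kappa> ^ 0 * D 0 z0)) / (f v - z0)"
    using period kappa_nz by (intro cycle_push_sum)
  \<comment> \<open>The cycle closes up exactly, since \<open>\<kappa> ^ p\<close> is the inverse of
    its multiplier.\<close>
  also have "cB / (\<kappa> ^ p * D p z0) - cB / (\<kappa> ^ 0 * D 0 z0) = 0"
  proof -
    have "inverse lam * lam = 1" using lam by (intro left_inverse) auto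
    then show ?thesis unfolding kappa_power multiplier D_zero by simp
  qed
  also have "cA / (\<kappa> ^ m * D m w) - cA / (\<kappa> ^ 0 * D 0 w) = cA * (lam ^ n / \<rho> - 1)"
  proof -
    have "\<kappa> ^ m = inverse (lam ^ n)" by (simp add: m_def power_mult kappa_power power_inverse)
    then have "cA / (\<kappa> ^ m * D m w) = cA * (lam ^ n / D m w)" by (simp only: divide_inverse inverse_mult_distrib inverse_inverse_eq)
    moreover have "\<rho> = D m w" unfolding \<rho>_def m_def ..
    ultimately show ?thesis unfolding D_zero by (simp only: right_diff_distrib) simp
  qed
  also have "(\<Sum>k<m. cA / (\<kappa> ^ k * D k w) / (f v - (f ^^ k) w)) = \<phi> (f v) - (\<Sum>k<p. cB / (\<kappa> ^ k * D k z0) / (f v - (f ^^ k) z0))"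
    unfolding \<phi>_def sum_poles[of "\<lambda>b y. b / (f v - y)"] by simp
  finally have *: "\<phi> v + \<phi> (- v) =
      4 * v\<^sup>2 * (\<kappa> * (\<phi> (f v) - S) + \<kappa> * X / (f v - w) + (\<kappa> * S + \<kappa> * 0 / (f v - z0))) - 4 * 0"
    if "S = (\<Sum>k<p. cB / (\<kappa> ^ k * D k z0) / (f v - (f ^^ k) z0))" "X = cA * (lam ^ n / \<rho> - 1)" for S X
    unfolding that .
  show ?thesis unfolding *[OF refl refl] by (simp only: right_diff_distrib) simp
qed

definition P :: "complex poly" where "P = partial_fraction_num {..<m + p} b y"

lemma phi_eq:
  assumes "\<And>k. k < m + p \<Longrightarrow> z \<noteq> y k"
  shows "\<phi> z = poly P z / (\<Prod>k<m + p. z - y k)"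
  unfolding \<phi>_def P_def using assms by (intro partial_fraction_eq) auto

text \<open>If \<open>P\<close> were zero, all residues would vanish because the poles are distinct;
  but \<open>b 0\<close> is \<open>cA\<close> and \<open>b m\<close> is \<open>cB\<close>.\<close>

lemma P_nz: "P \<noteq> 0"
proof
  assume "P = 0"
  have "b k = 0" if "k < m + p" for k
  proof -
    have "b k * (\<Prod>j\<in>{..<m + p} - {k}. y k - y j) = 0"
      using partial_fraction_residue[of "{..<m + p}" k b y] that \<open>P = 0\<close> by (simp add: P_def)
    moreover have "(\<Prod>j\<in>{..<m + p} - {k}. y k - y j) \<noteq> 0"
      using inj_y that by (auto simp: inj_on_def)
    ultimately show ?thesis by simp
  qed
  from this[of 0] this[of m] show False
    using cA_cB(2) m_pos p_pos by (auto simp: b_def D_def)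
qed

lemma degree_P: "degree P \<le> m + p"
  using degree_partial_fraction_num[of "{..<m + p}" b y] by (simp add: P_def)

section \<open>Lower bounds for the denominator\<close>

lemma far_factor:
  assumes "k < m + p" "i < p" "cls k \<noteq> i" "norm (v - a i) \<le> 16 * L * r"
  shows "\<sigma> \<le> norm (v - y k)"
proof -
  have "4 * \<sigma> \<le> norm (a i - a (cls k))" using y_near[OF assms(1)] assms by (intro sep) auto
  also have "\<dots> = norm ((v - y k) + (y k - a (cls k)) - (v - a i))" by simp
  also have "\<dots> \<le> norm (v - y k) + norm (y k - a (cls k)) + norm (v - a i)"
    using norm_triangle_ineq4[of "(v - y k) + (y k - a (cls k))" "v - a i"]
      norm_triangle_ineq[of "v - y k" "y k - a (cls k)"] by linarith
  finally show ?thesis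
    using y_near[OF assms(1)] assms(4) cutoff_radius_small(1) r_le_Lr r_pos sigma by linarith
qed

text \<open>Only poles of class \<open>i\<close> can be close to \<open>v\<close>; every other
  factor is at least \<open>\<sigma>\<close>. As \<open>\<sigma> \<le> 1\<close>, their number may
  be rounded up to \<open>m + p\<close>.\<close>

lemma prod_split_ge:
  assumes "I' \<subseteq> {..<m + p}" "i < p" "norm (v - a i) \<le> 16 * L * r"
  shows "(\<Prod>k\<in>{k\<in>I'. cls k = i}. norm (v - y k)) * \<sigma> ^ (m + p) \<le> (\<Prod>k\<in>I'. norm (v - y k))"
proof -
  have fin: "finite I'" using assms(1) finite_subset by blast
  have "(\<Prod>k\<in>I'. norm (v - y k)) = (\<Prod>k\<in>{k\<in>I'. cls k = i} \<union> {k\<in>I'. cls k \<noteq> i}. norm (v - y k))"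
    by (rule prod.cong) auto
  also have "\<dots> = (\<Prod>k\<in>{k\<in>I'. cls k = i}. norm (v - y k)) * (\<Prod>k\<in>{k\<in>I'. cls k \<noteq> i}. norm (v - y k))"
    using fin by (intro prod.union_disjoint) auto
  finally have split: "(\<Prod>k\<in>I'. norm (v - y k))
      = (\<Prod>k\<in>{k\<in>I'. cls k = i}. norm (v - y k)) * (\<Prod>k\<in>{k\<in>I'. cls k \<noteq> i}. norm (v - y k))" .
  have "(\<Prod>k\<in>{k\<in>I'. cls k \<noteq> i}. norm (v - y k)) \<ge> \<sigma> ^ card {k\<in>I'. cls k \<noteq> i}"
    using assms sigma by (intro prod_ge_power far_factor) auto
  moreover have "card {k\<in>I'. cls k \<noteq> i} \<le> card {..<m + p}" using assms(1) by (intro card_mono) auto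
  then have "\<sigma> ^ (m + p) \<le> \<sigma> ^ card {k\<in>I'. cls k \<noteq> i}" using sigma by (intro power_decreasing) auto
  ultimately show ?thesis
    unfolding split by (intro mult_left_mono) (auto intro: prod_nonneg)
qed

lemma cls_eq:
  assumes "i < p"
  shows "{k\<in>{..<m + p}. cls k = i} = insert (m + i) ((\<lambda>j. i + p * j) ` {..<n})"
proof (intro equalityI subsetI)
  fix k assume k: "k \<in> {k\<in>{..<m + p}. cls k = i}"
  show "k \<in> insert (m + i) ((\<lambda>j. i + p * j) ` {..<n})"
  proof (cases "k < m")
    case True
    then have "k = i + p * (k div p)" using k by (auto simp: cls_def)
    moreover have "k div p < n" using True p_pos unfolding m_def by (simp add: less_mult_imp_div_less mult.commute)
    ultimately show ?thesis by blast
  qed (use k in \<open>auto simp: cls_def\<close>)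
next
  fix k assume "k \<in> insert (m + i) ((\<lambda>j. i + p * j) ` {..<n})"
  then show "k \<in> {k\<in>{..<m + p}. cls k = i}"
    using assms index_lt[OF assms] by (auto simp: cls_def m_def trans_less_add1)
qed

text \<open>A class has only \<open>n + 1\<close> poles: \<open>n\<close> on the orbit of
  \<open>w\<close> and one on the cycle. This exponent competes with the \<open>2 * n + 1\<close> of
  \<open>displacement_bound\<close>.\<close>

lemma Q_lower:
  assumes "i < p" "norm (v - a i) \<le> 16 * L * r" "\<And>k. k < m + p \<Longrightarrow> r \<le> norm (v - y k)"
  shows "r ^ (n + 1) * \<sigma> ^ (m + p) \<le> norm (\<Prod>k<m + p. v - y k)"
proof -
  have c: "card {k\<in>{..<m + p}. cls k = i} \<le> n + 1"
    unfolding cls_eq[OF assms(1)] using card_image_le[of "{..<n}" "\<lambda>j. i + p * j"] 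
    by (simp add: card_insert_if)
  have r1: "r \<le> 1" using cutoff_radius_small(2) r_le_Lr r_pos by linarith
  have "r ^ (n + 1) \<le> r ^ card {k\<in>{..<m + p}. cls k = i}" using c r1 r_pos by (intro power_decreasing) auto
  also have "\<dots> \<le> (\<Prod>k\<in>{k\<in>{..<m + p}. cls k = i}. norm (v - y k))"
    using assms(3) r_pos by (intro prod_ge_power) auto
  finally have "r ^ (n + 1) * \<sigma> ^ (m + p) \<le> (\<Prod>k\<in>{k\<in>{..<m + p}. cls k = i}. norm (v - y k)) * \<sigma> ^ (m + p)"
    using sigma by (intro mult_right_mono) auto
  also have "\<dots> \<le> (\<Prod>k\<in>{..<m + p}. norm (v - y k))" using assms by (intro prod_split_ge) auto
  finally show ?thesis by (simp add: prod_norm)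
qed

text \<open>Bounds the residue \<open>cA\<close> of \<open>\<phi>\<close> at \<open>w\<close> by the size of \<open>P\<close>; the powers of \<open>u\<close> cancel against those in \<open>T\<close>.\<close>

lemma residue_lower:
  "u * (u / (8 * n)) ^ (n - 1) * \<sigma> ^ (m + p) \<le> (\<Prod>k\<in>{..<m + p} - {0}. norm (w - y k))"
proof -
  \<comment> \<open>Without \<open>w\<close> itself, class 0 consists of the cycle point with index
    \<open>m\<close> and the \<open>n - 1\<close> other points of the strand. The former is at
    distance \<open>u\<close>, the latter are kept away by \<open>return_separation\<close>.\<close>
  have e: "{k\<in>{..<m + p} - {0}. cls k = 0} = insert m ((\<lambda>j. p * j) ` {1..<n})"
  proof -
    have "{k\<in>{..<m + p} - {0}. cls k = 0} = {k\<in>{..<m + p}. cls k = 0} - {0}" by auto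
    also have "\<dots> = insert m ((\<lambda>j. p * j) ` {..<n}) - {0}" unfolding cls_eq[OF p_pos] by simp
    also have "\<dots> = insert m ((\<lambda>j. p * j) ` {1..<n})" using m_pos p_pos by force
    finally show ?thesis .
  qed
  have m_notin: "m \<notin> (\<lambda>j. p * j) ` {1..<n}" using p_pos by (auto simp: m_def)
  have c: "card ((\<lambda>j. p * j) ` {1..<n}) = n - 1" using p_pos by (subst card_image) (auto simp: inj_on_def)
  have "u * (u / (8 * n)) ^ (n - 1) \<le> norm (w - y m) * (\<Prod>k\<in>(\<lambda>j. p * j) ` {1..<n}. norm (w - y k))"
  proof (intro mult_mono)
    show "u \<le> norm (w - y m)" by (simp add: u_def y_def)
    show "(u / (8 * n)) ^ (n - 1) \<le> (\<Prod>k\<in>(\<lambda>j. p * j) ` {1..<n}. norm (w - y k))"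
      unfolding c[symmetric]
    proof (rule prod_ge_power)
      fix k assume "k \<in> (\<lambda>j. p * j) ` {1..<n}"
      then obtain j where j: "1 \<le> j" "j < n" "k = p * j" by auto
      have kp: "0 < p * j" "p * j < p * n" using j p_pos by auto
      have "u / (8 * n) \<le> norm ((f ^^ (p * j)) w - w)"
        unfolding u_def
      proof (rule return_separation[OF n1 small_B])
        show "norm ((f ^^ (p * l)) w - a 0) \<le> r" for l
          using shadow(1)[of "p * l"] a_add_period[of 0 l] by simp
        show "(f ^^ (p * j)) w \<noteq> w" using min_per(1) kp by (simp add: minimal_period_def)
      qed (use per j in auto)
      then show "u / (8 * n) \<le> norm (w - y k)" using j kp by (simp add: y_def m_def norm_minus_commute)
    qed (use u_pos in auto)
  qed (use u_pos in \<open>auto intro!: prod_nonneg\<close>)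
  also have "\<dots> = (\<Prod>k\<in>{k\<in>{..<m + p} - {0}. cls k = 0}. norm (w - y k))"
    unfolding e using m_notin by simp
  finally have "u * (u / (8 * n)) ^ (n - 1) * \<sigma> ^ (m + p)
      \<le> (\<Prod>k\<in>{k\<in>{..<m + p} - {0}. cls k = 0}. norm (w - y k)) * \<sigma> ^ (m + p)"
    using sigma by (intro mult_right_mono) auto
  also have "\<dots> \<le> (\<Prod>k\<in>{..<m + p} - {0}. norm (w - y k))"
  proof (rule prod_split_ge)
    show "norm (w - a 0) \<le> 16 * L * r" using u_le r_le_Lr r_pos unfolding u_def by linarith
  qed (use p_pos in auto)
  finally show ?thesis .
qed

section \<open>The cut-off around the poles\<close>

text \<open>A ramp in \<open>drift\<close>, from 0 at \<open>8 * L * r\<close> to 1 at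
  \<open>16 * L * r\<close>. Using \<open>drift\<close> in place of the distance to the cycle makes
  the growth of the weight under \<open>f\<close> as small as the displacement.\<close>

definition wt :: "complex \<Rightarrow> real" where
  "wt z = min 1 (max 0 (drift m z / (8 * L * r) - 1))"

lemma scale_pos: "8 * L * r > 0" using L r_pos by simp

lemma wt_range: "0 \<le> wt z" "wt z \<le> 1" by (auto simp: wt_def)

lemma continuous_wt: "continuous_on UNIV wt"
  unfolding wt_def[abs_def] using scale_pos
  by (intro continuous_on_min continuous_on_max continuous_intros continuous_drift) auto

text \<open>From within \<open>4 * r\<close> of the cycle, \<open>near_iter\<close> keeps all
  iterates up to \<open>m\<close> within \<open>8 * L * r\<close>. Index \<open>m\<close> itself is
  included because the first \<open>m\<close> iterates of \<open>f v\<close> are iterates of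
  \<open>v\<close> up to that index.\<close>

lemma drift_far:
  assumes "k \<le> m" "infdist ((f ^^ k) z) cyc > 8 * L * r"
  shows "infdist z cyc \<ge> 4 * r"
proof (rule ccontr)
  assume "\<not> ?thesis"
  moreover obtain i where i: "infdist z cyc = norm (z - a i)" using nearest_cyc by blast
  ultimately have d: "norm (z - a i) < 4 * r" by simp
  then have "norm (z - a i) \<le> 1 / (4 * B * n)" using four_r_le by linarith
  then have "norm ((f ^^ k) z - a (i + k)) \<le> 2 * L * norm (z - a i)"
    using near_iter[of n k z i] n1 assms(1) by (simp add: m_def)
  also have "\<dots> \<le> 2 * L * (4 * r)" using d L by (intro mult_left_mono) auto
  finally show False using assms(2) infdist_cyc_le[of "(f ^^ k) z" "i + k"] by linarith
qed

lemma wt_pos_drift: "wt z > 0 \<Longrightarrow> drift m z > 8 * L * r"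
  using scale_pos by (auto simp: wt_def min_def max_def field_simps split: if_splits)

lemma far_poles:
  assumes "infdist z cyc \<ge> 4 * r" "k < m + p"
  shows "3 * r \<le> norm (z - y k)"
  using infdist_cyc_le[of z "cls k"] assms y_near[OF assms(2)]
    norm_triangle_ineq[of "z - y k" "y k - a (cls k)"] by simp

lemma wt_pos_far:
  assumes "wt z > 0" "k < m + p"
  shows "3 * r \<le> norm (z - y k)"
proof -
  obtain l where "l < m" "infdist ((f ^^ l) z) cyc > 8 * L * r"
    using drift_gtD[OF wt_pos_drift[OF assms(1)]] scale_pos by auto
  then show ?thesis using drift_far[of l z] far_poles assms(2) by simp
qed

lemma iter_pole: "k < m + p \<Longrightarrow> \<exists>j<m + p. (f ^^ l) (y k) = y j"
proof (induction l)
  case (Suc l)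
  then obtain j where "j < m + p" "(f ^^ l) (y k) = y j" by auto
  then show ?case using f_maps_poles[of j] by auto
qed auto

text \<open>Poles are mapped to poles, and all poles lie within \<open>r\<close> of the
  cycle.\<close>

lemma drift_pole: assumes "k < m + p" shows "drift m (y k) < 8 * L * r"
proof -
  have "\<not> drift m (y k) > r"
  proof
    assume "drift m (y k) > r"
    then obtain l where l: "infdist ((f ^^ l) (y k)) cyc > r" using drift_gtD[of r m "y k"] r_pos by auto
    obtain j where "j < m + p" "(f ^^ l) (y k) = y j" using iter_pole[OF assms] by blast
    then show False using l y_near[of j] infdist_cyc_le[of "y j" "cls j"] by simp
  qed
  then show ?thesis using r_le_Lr r_pos by linarith
qed

lemma wt_pos_regular:
  assumes "wt (f v) > 0" "k < m + p"
  shows "v \<noteq> y k \<and> - v \<noteq> y k"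
proof -
  have "f (- v) = f v" by (simp add: f_eq)
  moreover have "wt (f (y k)) = 0"
  proof -
    obtain j where j: "j < m + p" "f (y k) = y j" using f_maps_poles[OF assms(2)] by blast
    then show ?thesis using drift_pole[OF j(1)] wt_pos_drift[of "y j"] wt_range(1)[of "y j"] by fastforce
  qed
  ultimately show ?thesis using assms(1) by force
qed

text \<open>The weight vanishes on an open set that contains all poles, whatever values
  \<open>g\<close> takes there, and off the poles \<open>g\<close> is continuous. The two open sets
  cover the plane. \<open>h\<close> will be the identity or \<open>f\<close>.\<close>

lemma continuous_cutoff:
  fixes g :: "complex \<Rightarrow> real"
  assumes "continuous_on {z. \<forall>k<m + p. z \<noteq> y k} g" "continuous_on UNIV h"
    and "\<And>k. k < m + p \<Longrightarrow> drift m (h (y k)) < 8 * L * r"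
  shows "continuous_on UNIV (\<lambda>z. wt (h z) * g z)"
proof -
  define U where "U = {z. drift m (h z) < 8 * L * r}"
  define V where "V = {z. \<forall>k<m + p. z \<noteq> y k}"
  have h: "continuous_on UNIV (\<lambda>z. drift m (h z))" "continuous_on UNIV (\<lambda>z. wt (h z))"
    using continuous_on_compose2[OF continuous_drift assms(2)] continuous_on_compose2[OF continuous_wt assms(2)] by auto
  have "open U" unfolding U_def using h(1) by (intro open_Collect_less) auto
  moreover have "open V"
  proof -
    have "V = - (y ` {..<m + p})" by (auto simp: V_def)
    then show ?thesis by (simp add: finite_imp_closed open_Compl)
  qed
  moreover have "continuous_on U (\<lambda>z. wt (h z) * g z)"
  proof (rule continuous_on_eq[OF continuous_on_const[of U 0]])
    fix z assume "z \<in> U"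
    then have "\<not> wt (h z) > 0" using wt_pos_drift by (force simp: U_def)
    then show "0 = wt (h z) * g z" using wt_range(1)[of "h z"] by simp
  qed
  moreover have "continuous_on V (\<lambda>z. wt (h z) * g z)"
    using assms(1) h(2) unfolding V_def by (intro continuous_on_mult) (auto intro: continuous_on_subset)
  ultimately have "continuous_on (U \<union> V) (\<lambda>z. wt (h z) * g z)" by (rule continuous_on_open_Un)
  moreover have "U \<union> V = UNIV" using assms(3) by (auto simp: U_def V_def)
  ultimately show ?thesis by simp
qed

lemma y_zero: "y 0 = w" using m_pos by (simp add: y_def)

text \<open>A majorant of the mismatch term in \<open>phi_push\<close>.\<close>

definition err :: "complex \<Rightarrow> real" where "err z = norm cA * (4 * T) / norm (z - w)"

lemma T_nonneg: "T \<ge> 0" using lam_power_bound norm_ge_zero order_trans by blast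

lemma push_ineq:
  assumes "wt (f v) > 0"
  shows "4 * (norm v)\<^sup>2 * (norm (\<phi> (f v)) - err (f v)) \<le> norm (\<phi> v) + norm (\<phi> (- v))"
proof -
  define X where "X = cA * (lam ^ n / \<rho> - 1) / (f v - w)"
  have "\<phi> v + \<phi> (- v) = 4 * v\<^sup>2 * (\<kappa> * \<phi> (f v) + \<kappa> * (cA * (lam ^ n / \<rho> - 1)) / (f v - w))"
    using wt_pos_regular[OF assms] by (rule phi_push)
  also have "\<dots> = 4 * v\<^sup>2 * (\<kappa> * (\<phi> (f v) + X))" by (simp add: X_def distrib_left)
  finally have "norm (\<phi> v + \<phi> (- v)) = 4 * (norm v)\<^sup>2 * norm (\<phi> (f v) + X)"
    by (simp add: norm_mult norm_power norm_kappa)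
  moreover have "norm X \<le> err (f v)"
    unfolding X_def err_def norm_divide norm_mult
    by (intro divide_right_mono mult_left_mono multiplier_ratio) auto
  then have "norm (\<phi> (f v)) - err (f v) \<le> norm (\<phi> (f v) + X)"
    using norm_diff_ineq[of "\<phi> (f v)" X] by linarith
  then have "4 * (norm v)\<^sup>2 * (norm (\<phi> (f v)) - err (f v)) \<le> 4 * (norm v)\<^sup>2 * norm (\<phi> (f v) + X)"
    by (intro mult_left_mono) auto
  ultimately show ?thesis using norm_triangle_ineq[of "\<phi> v" "\<phi> (- v)"] by linarith
qed

lemma R_ge: "R \<ge> 4" using R norm_ge_zero[of c] by linarith

lemma r_le_1: "r \<le> 1" using cutoff_radius_small(2) r_le_Lr r_pos by linarith

lemma y_bound: assumes "k < m + p" shows "norm (y k) \<le> R - 3"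
  using y_near[OF assms] a_bound[of "cls k"] r_le_1 norm_triangle_ineq[of "y k - a (cls k)" "a (cls k)"] by simp

lemma wt_outer:
  assumes "norm z \<ge> R - 1" shows "wt z = 1"
proof -
  obtain i where i: "infdist z cyc = norm (z - a i)" using nearest_cyc by blast
  have "norm (z - a i) \<ge> 3" using assms a_bound[of i] norm_triangle_ineq2[of z "a i"] by linarith
  then have "drift m z \<ge> 3" using drift_ge[of 0 m z] m_pos i by simp
  then have "drift m z / (8 * L * r) \<ge> 2" using cutoff_radius_small(2) scale_pos by (subst pos_le_divide_eq) auto
  then show ?thesis by (simp add: wt_def)
qed

section \<open>Gain, defect and the resulting lower bound for \<open>r\<close>\<close>

definition gain :: real where
  "gain = (136 * B * L * n) ^ (2 * n + 1) * r ^ (n - 1) / \<sigma> ^ (m + p)"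

definition defect :: real where
  "defect = 2 * 6 ^ n * (8 * real n) ^ (n - 1) * (8 * B * n) ^ (2 * n + 1) * r ^ (n - 1) / \<sigma> ^ (m + p)"

text \<open>Where the weight grows, it is below 1 at \<open>v\<close> and positive at
  \<open>f v\<close>; so \<open>v\<close> is within \<open>16 * L * r\<close> of the cycle but at
  least \<open>4 * r\<close> away from it. There the growth is at most the displacement over
  \<open>8 * L * r\<close>, and the denominator of \<open>\<phi>\<close> is bounded below by
  \<open>Q_lower\<close>. The powers of \<open>r\<close> combine to
  \<open>(2 * n + 1) - 1 - (n + 1) = n - 1\<close>.\<close>

lemma gain_bound:
  assumes M: "M \<ge> 0" "\<And>z. norm z \<le> R \<Longrightarrow> norm (poly P z) \<le> M" and v: "norm v \<le> R"
  shows "(wt (f v) - wt v) * norm (\<phi> v) \<le> M * gain"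
proof (cases "wt (f v) \<le> wt v")
  case True
  then have "(wt (f v) - wt v) * norm (\<phi> v) \<le> 0" by (intro mult_nonpos_nonneg) auto
  also have "0 \<le> M * gain" using M B L r_pos sigma unfolding gain_def by auto
  finally show ?thesis .
next
  case False
  then have lt: "wt v < wt (f v)" by simp
  then have pos: "wt (f v) > 0" using wt_range(1)[of v] by linarith
  have "wt v < 1" using lt wt_range(2)[of "f v"] by linarith
  then have "drift m v / (8 * L * r) - 1 < 1" by (auto simp: wt_def min_def split: if_splits)
  then have drift_v: "drift m v < 16 * L * r" using scale_pos by (simp add: field_simps)
  obtain i where i: "i < p" "infdist v cyc = norm (v - a i)" using nearest_cyc by blast
  have vi: "norm (v - a i) \<le> 16 * L * r" using drift_ge[of 0 m v] m_pos drift_v i by simp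
  \<comment> \<open>Only the distance at time \<open>m\<close> is new for \<open>f v\<close>, and it
    exceeds the distance of \<open>v\<close> itself by at most the displacement.\<close>
  have up: "wt (f v) - wt v \<le> norm (displacement n v) / (8 * L * r)"
  proof -
    have "drift m (f v) \<le> drift m v + norm (displacement n v)"
    proof -
      have "infdist ((f ^^ m) v) cyc \<le> infdist v cyc + norm (displacement n v)"
        using infdist_triangle[of "(f ^^ m) v" cyc v]
        by (simp add: dist_norm displacement_def m_def)
      moreover have "infdist v cyc \<le> drift m v" using drift_ge[of 0 m v] m_pos by simp
      ultimately show ?thesis
        using drift_shift[of m v] norm_ge_zero[of "displacement n v"] by linarith
    qed
    then have "drift m (f v) / (8 * L * r) \<le> drift m v / (8 * L * r) + norm (displacement n v) / (8 * L * r)"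
      using scale_pos by (simp add: add_divide_distrib[symmetric] divide_right_mono)
    moreover have "norm (displacement n v) / (8 * L * r) \<ge> 0" using scale_pos by simp
    ultimately show ?thesis by (auto simp: wt_def min_def max_def)
  qed
  have far: "infdist v cyc \<ge> 4 * r"
  proof -
    obtain l where l: "l < m" "infdist ((f ^^ l) (f v)) cyc > 8 * L * r"
      using drift_gtD[OF wt_pos_drift[OF pos]] scale_pos by auto
    then show ?thesis using drift_far[of "Suc l" v] by (simp add: funpow_swap1)
  qed
  have yk: "r \<le> norm (v - y k)" "v \<noteq> y k" if "k < m + p" for k
    using far_poles[OF far that] r_pos by auto
  have Q: "r ^ (n + 1) * \<sigma> ^ (m + p) \<le> norm (\<Prod>k<m + p. v - y k)"
    using Q_lower[OF i(1) vi] yk by blast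
  have Qpos: "r ^ (n + 1) * \<sigma> ^ (m + p) > 0" using r_pos sigma by simp
  have pe: "\<phi> v = poly P v / (\<Prod>k<m + p. v - y k)" using yk(2) by (rule phi_eq)
  have ph: "norm (\<phi> v) \<le> M / (r ^ (n + 1) * \<sigma> ^ (m + p))"
    unfolding pe norm_divide
    using M(2)[OF v] Q Qpos M(1) by (intro frac_le) auto
  have "wt (f v) - wt v \<le> (136 * B * L * n * r) ^ (2 * n + 1) / r"
  proof -
    have "norm (displacement n v) / (8 * L * r) \<le> (136 * B * L * n * r) ^ (2 * n + 1) / r"
      using displacement_bound[OF i(1) vi] r_pos r_le_Lr B L
      by (intro frac_le zero_le_power mult_nonneg_nonneg) auto
    then show ?thesis using up by linarith
  qed
  then have "(wt (f v) - wt v) * norm (\<phi> v)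
      \<le> ((136 * B * L * n * r) ^ (2 * n + 1) / r) * (M / (r ^ (n + 1) * \<sigma> ^ (m + p)))"
    using ph lt r_pos B L by (intro mult_mono) auto
  also have "\<dots> = M * gain"
  proof -
    have "r ^ (2 * n + 1) = r * r ^ (n + 1) * r ^ (n - 1)"
    proof -
      have "2 * n + 1 = 1 + (n + 1) + (n - 1)" using n2 by simp
      then show ?thesis by (metis power_add power_one_right)
    qed
    then show ?thesis using r_pos unfolding gain_def power_mult_distrib[of "136 * B * L * n" r]
      by (simp add: field_simps)
  qed
  finally show ?thesis .
qed

text \<open>The value of \<open>P\<close> at \<open>w\<close> bounds the residue \<open>cA\<close>
  through \<open>residue_lower\<close>, and where the weight is positive the pole at
  \<open>w\<close> is at least \<open>3 * r\<close> away.\<close>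

lemma defect_bound:
  assumes M: "M \<ge> 0" "\<And>z. norm z \<le> R \<Longrightarrow> norm (poly P z) \<le> M"
  shows "wt z * err z \<le> M * defect"
proof (cases "wt z > 0")
  case False
  then have "wt z * err z = 0" using wt_range(1)[of z] by simp
  then show ?thesis using M B r_pos sigma unfolding defect_def by auto
next
  case True
  have zw: "norm (z - w) \<ge> 3 * r" using wt_pos_far[OF True, of 0] m_pos by (simp add: y_zero)
  define q where "q = u * (u / (8 * n)) ^ (n - 1) * \<sigma> ^ (m + p)"
  have q: "q > 0" using u_pos sigma nR by (simp add: q_def)
  have cA: "norm cA * q \<le> M"
  proof -
    have b0: "b 0 = cA" using m_pos by (simp add: b_def D_zero)
    have "norm (poly P w) = norm cA * (\<Prod>k\<in>{..<m + p} - {0}. norm (w - y k))"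
      using partial_fraction_residue[of "{..<m + p}" 0 b y] m_pos b0
      by (simp add: P_def y_zero norm_mult prod_norm)
    moreover have "norm (poly P w) \<le> M" using M(2)[of w] y_bound[of 0] m_pos by (simp add: y_zero)
    ultimately show ?thesis
      using mult_left_mono[OF residue_lower norm_ge_zero[of cA]] by (simp add: q_def)
  qed
  have "wt z * err z \<le> 1 * err z"
    using wt_range(2)[of z] T_nonneg by (intro mult_right_mono) (auto simp: err_def)
  also have "err z \<le> norm cA * (4 * T) / (3 * r)"
    unfolding err_def using zw r_pos T_nonneg by (intro divide_left_mono mult_pos_pos) auto
  also have "\<dots> \<le> (M / q) * (4 * T) / (3 * r)"
    using cA q r_pos T_nonneg by (intro divide_right_mono mult_right_mono) (auto simp: field_simps)
  also have "\<dots> = M * (4 / 3) * (T / (q * r))" by simp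
  \<comment> \<open>\<open>T\<close> contains \<open>u ^ n * r ^ n\<close> and \<open>q\<close>
    contains \<open>u ^ n\<close>, so \<open>u\<close> disappears and \<open>r ^ (n - 1)\<close>
    remains.\<close>
  also have "T / (q * r) = 6 ^ n * (8 * real n) ^ (n - 1) * (8 * B * n) ^ (2 * n + 1) * r ^ (n - 1) / \<sigma> ^ (m + p)"
  proof -
    have e: "x ^ n = x * x ^ (n - 1)" for x :: real using n2 by (metis power_minus_mult mult.commute zero_less_numeral order_less_le_trans)
    have "T = 6 ^ n * (u * u ^ (n - 1)) * (r * r ^ (n - 1)) * (8 * B * n) ^ (2 * n + 1)"
      unfolding T_def power_mult_distrib e[of u, symmetric] e[of r, symmetric]
      using power_mult_distrib[of "3::real" 2 n] by simp
    moreover have "q = u * u ^ (n - 1) / (8 * real n) ^ (n - 1) * \<sigma> ^ (m + p)"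
      by (simp add: q_def power_divide)
    moreover have "C * (u' * U) * (r' * V) * H / (u' * U / E * S * r') = C * E * H * V / S"
      if "u' \<noteq> 0" "U \<noteq> 0" "r' \<noteq> 0" "E \<noteq> 0" "S \<noteq> 0" for C u' U r' V H E S :: real
      using that by (simp add: field_simps)
    ultimately show ?thesis using u_pos r_pos sigma nR by (simp only:) simp
  qed
  also have "M * (4 / 3) * \<dots> \<le> M * defect"
  proof -
    define X where "X = 6 ^ n * (8 * real n) ^ (n - 1) * (8 * B * n) ^ (2 * n + 1) * r ^ (n - 1) / \<sigma> ^ (m + p)"
    have "defect = 2 * X" by (simp add: defect_def X_def)
    moreover have "X \<ge> 0" using B r_pos sigma by (auto simp: X_def)
    ultimately have "(4 / 3) * X \<le> defect" by simp
    then have "M * ((4 / 3) * X) \<le> M * defect" using M(1) by (rule mult_left_mono)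
    then show ?thesis unfolding X_def by (simp only: mult.assoc)
  qed
  finally show ?thesis by simp
qed

text \<open>Loss, gain and defect are all proportional to the bound \<open>M\<close> for
  \<open>P\<close>, which therefore cancels. In \<open>(16 * R) ^ N\<close>, the factor
  \<open>2 ^ N\<close> enters three times, once from the lower bound for \<open>P\<close> and twice
  from \<open>\<tau>\<^sup>2\<close>, and \<open>(2 * R) ^ N\<close> comes from the denominator of
  \<open>\<phi>\<close>.\<close>

lemma transfer_inequality:
  "1 \<le> 512 * R\<^sup>2 * (16 * R) ^ (m + p) * (defect + gain)"
proof -
  define N where "N = m + p"
  define \<tau> :: real where "\<tau> = 1 / (8 * 2 ^ N)"
  have \<tau>: "0 < \<tau>" "\<tau> \<le> 1/4"
  proof -
    have "(1::real) \<le> 2 ^ N" by simp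
    then have "(4::real) \<le> 8 * 2 ^ N" by linarith
    then have "1 / (8 * 2 ^ N) \<le> 1 / (4::real)" by (intro frac_le) auto
    then show "0 < \<tau>" "\<tau> \<le> 1/4" unfolding \<tau>_def by auto
  qed
  obtain M \<zeta> where M: "M > 0" "\<And>z. norm z \<le> R \<Longrightarrow> norm (poly P z) \<le> M" "norm \<zeta> = R - 1/2"
    "\<And>z. z \<in> ball \<zeta> \<tau> \<Longrightarrow> norm (poly P z) \<ge> M / 2 ^ (N + 1)"
    using poly_large_on_ball[OF P_nz degree_P, of R] R_ge unfolding \<tau>_def N_def by auto
  define mm where "mm = M / 2 ^ (N + 1) / (2 * R) ^ N"
  have dn: "defect \<ge> 0" "gain \<ge> 0" using B L r_pos sigma by (auto simp: defect_def gain_def)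
  have phc: "continuous_on {z. \<forall>k<m + p. z \<noteq> y k} (\<lambda>z. norm (\<phi> z))"
    unfolding \<phi>_def by (intro continuous_intros) auto
  have erc: "continuous_on {z. \<forall>k<m + p. z \<noteq> y k} err"
    unfolding err_def[abs_def] using m_pos y_zero by (intro continuous_intros) force+
  have fd: "drift m (f (y k)) < 8 * L * r" if "k < m + p" for k
    using f_maps_poles[OF that] drift_pole by auto
  have cf: "continuous_on UNIV f" unfolding f_eq by (intro continuous_intros)
  have "mm * \<tau>\<^sup>2 \<le> (M * defect + M * gain) * (4 * R\<^sup>2)"
  proof (rule quadratic_contraction[where c = c and R = R and wt = wt and ph = "\<lambda>z. norm (\<phi> z)" and er = err and \<zeta> = \<zeta>])
    show "continuous_on (cball 0 R) (\<lambda>z. wt z * norm (\<phi> z))"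
      using continuous_cutoff[OF phc, of "\<lambda>z. z"] drift_pole by (auto intro: continuous_on_subset)
    show "continuous_on (cball 0 R) (\<lambda>z. wt z * err z)"
      using continuous_cutoff[OF erc, of "\<lambda>z. z"] drift_pole by (auto intro: continuous_on_subset)
    show "continuous_on {w. w\<^sup>2 + c \<in> cball 0 R} (\<lambda>w. wt (w\<^sup>2 + c) * norm (\<phi> w))"
      using continuous_cutoff[OF phc cf fd] by (auto intro: continuous_on_subset simp: f_eq)
    show "4 * (norm v)\<^sup>2 * (norm (\<phi> (v\<^sup>2 + c)) - err (v\<^sup>2 + c)) \<le> norm (\<phi> v) + norm (\<phi> (- v))"
      if "wt (v\<^sup>2 + c) > 0" for v
      using push_ineq[of v] that by (simp add: f_eq)
    show "wt z * err z \<le> M * defect" for z using defect_bound M by (simp add: less_imp_le)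
    show "(wt (v\<^sup>2 + c) - wt v) * norm (\<phi> v) \<le> M * gain" if "norm v \<le> R" for v
      using gain_bound[of M v] M that by (simp add: f_eq less_imp_le)
    show "mm \<le> wt z * norm (\<phi> z)" if z: "z \<in> ball \<zeta> \<tau>" for z
    proof -
      have dz: "norm (z - \<zeta>) < \<tau>" using z by (simp add: dist_norm norm_minus_commute)
      have z1: "norm z \<ge> R - 1" "norm z \<le> R"
        using dz \<tau> M(3) norm_triangle_ineq2[of \<zeta> z] norm_triangle_ineq2[of z \<zeta>]
        by (auto simp: norm_minus_commute)
      have ny: "z \<noteq> y k" if "k < m + p" for k using y_bound[OF that] z1 by auto
      have "(\<Prod>k\<in>{..<m + p}. norm (z - y k)) \<le> (2 * R) ^ card {..<m + p}"
      proof (rule prod_le_power_card)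
        fix k assume "k \<in> {..<m + p}"
        then show "0 \<le> norm (z - y k) \<and> norm (z - y k) \<le> 2 * R"
          using y_bound[of k] z1 norm_triangle_ineq4[of z "y k"] by simp
      qed
      then have "norm (\<Prod>k<m + p. z - y k) \<le> (2 * R) ^ N" by (simp add: prod_norm N_def)
      moreover have "norm (\<Prod>k<m + p. z - y k) > 0" using ny by simp
      moreover have "\<phi> z = poly P z / (\<Prod>k<m + p. z - y k)" using ny by (rule phi_eq)
      ultimately have "mm \<le> norm (\<phi> z)"
        unfolding mm_def using M(1,4) z R_ge by (simp only: norm_divide) (intro frac_le, auto)
      then show ?thesis using wt_outer[OF z1(1)] by simp
    qed
  qed (use R M \<tau> dn wt_range R_ge in \<open>auto simp: mm_def\<close>)
  then have "M / 2 ^ (N + 1) / (2 * R) ^ N * (1 / (8 * 2 ^ N))\<^sup>2 \<le> M * ((defect + gain) * (4 * R\<^sup>2))"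
    by (simp add: mm_def \<tau>_def algebra_simps)
  then have "1 / 2 ^ (N + 1) / (2 * R) ^ N * (1 / (8 * 2 ^ N))\<^sup>2 \<le> (defect + gain) * (4 * R\<^sup>2)"
    using M(1) mult_le_cancel_left_pos[of M "1 / 2 ^ (N + 1) / (2 * R) ^ N * (1 / (8 * 2 ^ N))\<^sup>2"] by simp
  moreover have "1 / 2 ^ (N + 1) / (2 * R) ^ N * (1 / (8 * 2 ^ N))\<^sup>2 = 1 / (128 * (16 * R) ^ N)"
  proof -
    have "(2 * 2 * 2 * (2 * R)) ^ N = 2 ^ N * 2 ^ N * 2 ^ N * (2 * R) ^ N"
      by (simp only: power_mult_distrib)
    moreover have "2 * 2 * 2 * (2 * R) = 16 * R" by simp
    moreover have "1 / (2 * A) / C * (1 / (8 * A))\<^sup>2 = 1 / (128 * (A * A * A * C))" for A C :: real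
      by (simp add: power2_eq_square)
    ultimately show ?thesis by (simp only: power_Suc Suc_eq_plus1[symmetric])
  qed
  ultimately have "1 / (128 * (16 * R) ^ N) \<le> (defect + gain) * (4 * R\<^sup>2)" by simp
  then have "1 \<le> (defect + gain) * (4 * R\<^sup>2) * (128 * (16 * R) ^ N)"
    using R_ge by (subst (asm) pos_divide_le_eq) auto
  also have "\<dots> = 512 * R\<^sup>2 * (16 * R) ^ (m + p) * (defect + gain)" by (simp only: N_def) simp
  finally show ?thesis .
qed

text \<open>All constants are absorbed into \<open>n\<close>-th powers, using
  \<open>2 * n + 1 \<le> 4 * n\<close> and \<open>m + p \<le> 2 * p * n\<close>; then an
  \<open>n\<close>-th root is taken.\<close>

lemma small_cycles_bound:
  "1 \<le> (1024 * R\<^sup>2 * (16 * R / \<sigma>) ^ (2 * p) * (200 * B * L) ^ 4)\<^sup>2 * real n ^ 8 * r"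
proof -
  define X where "X = 200 * B * L * real n"
  have BL: "B * L \<ge> 1" using mult_mono[of 1 B 1 L] B L by simp
  have BLn: "B * L * real n \<ge> real n" "B * L * real n \<ge> B * real n"
    using mult_right_mono[OF BL, of "real n"] mult_left_mono[OF L, of "B * real n"] B by (auto simp: mult_ac)
  have X1: "X \<ge> 1" using BLn(1) nR unfolding X_def by linarith
  have g: "(136 * B * L * n) ^ (2 * n + 1) \<le> X ^ (4 * n)"
  proof -
    have "(136 * B * L * n) ^ (2 * n + 1) \<le> X ^ (2 * n + 1)"
      using B L by (intro power_mono) (auto simp: X_def)
    also have "\<dots> \<le> X ^ (4 * n)" using X1 n2 by (intro power_increasing) auto
    finally show ?thesis .
  qed
  have d: "2 * 6 ^ n * (8 * real n) ^ (n - 1) * (8 * B * n) ^ (2 * n + 1) \<le> X ^ (4 * n)"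
  proof -
    have "2 * 6 ^ n * (8 * real n) ^ (n - 1) \<le> X ^ n"
    proof -
      have "2 * 6 ^ n * (8 * real n) ^ (n - 1) \<le> (8 * real n) * 6 ^ n * (8 * real n) ^ (n - 1)"
        using nR by (intro mult_right_mono) auto
      also have "\<dots> = 6 ^ n * (8 * real n) ^ n"
        using n2 by (subst (3) power_eq_if) auto
      also have "\<dots> = (48 * real n) ^ n"
        unfolding power_mult_distrib[symmetric] by (rule arg_cong[where f = "\<lambda>x. x ^ n"]) simp
      also have "\<dots> \<le> X ^ n" using BLn(1) by (intro power_mono) (auto simp: X_def)
      finally show ?thesis .
    qed
    moreover have "(8 * B * n) ^ (2 * n + 1) \<le> X ^ (3 * n)"
    proof -
      have "8 * (B * n) \<le> 200 * (B * L * n)"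
      proof -
        have "0 \<le> B * n" using B by simp
        then show ?thesis using BLn(2) by linarith
      qed
      then have "(8 * B * n) ^ (2 * n + 1) \<le> X ^ (2 * n + 1)"
        using B by (intro power_mono) (auto simp: X_def mult_ac)
      also have "\<dots> \<le> X ^ (3 * n)" using X1 n2 by (intro power_increasing) auto
      finally show ?thesis .
    qed
    ultimately have "2 * 6 ^ n * (8 * real n) ^ (n - 1) * (8 * B * n) ^ (2 * n + 1) \<le> X ^ n * X ^ (3 * n)"
      using B X1 by (intro mult_mono) auto
    then show ?thesis by (simp flip: power_add)
  qed
  have dg: "defect + gain \<le> 2 * (X ^ (4 * n) * r ^ (n - 1) / \<sigma> ^ (m + p))"
  proof -
    have "defect \<le> X ^ (4 * n) * r ^ (n - 1) / \<sigma> ^ (m + p)" "gain \<le> X ^ (4 * n) * r ^ (n - 1) / \<sigma> ^ (m + p)"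
      unfolding defect_def gain_def using d g r_pos sigma by (auto intro!: divide_right_mono mult_right_mono)
    then show ?thesis by linarith
  qed
  define K where "K = 1024 * R\<^sup>2 * (16 * R / \<sigma>) ^ (2 * p) * (200 * B * L) ^ 4"
  have s1: "16 * R / \<sigma> \<ge> 1" using R_ge sigma by (simp add: field_simps)
  have R2: "1024 * R\<^sup>2 \<ge> 1"
  proof -
    have "1\<^sup>2 \<le> R\<^sup>2" using R_ge by (intro power_mono) auto
    then show ?thesis by simp
  qed
  have "1 \<le> 512 * R\<^sup>2 * (16 * R) ^ (m + p) * (2 * (X ^ (4 * n) * r ^ (n - 1) / \<sigma> ^ (m + p)))"
    using transfer_inequality mult_left_mono[OF dg, of "512 * R\<^sup>2 * (16 * R) ^ (m + p)"] R_ge by simp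
  also have "\<dots> = 1024 * R\<^sup>2 * (16 * R / \<sigma>) ^ (m + p) * (X ^ (4 * n) * r ^ (n - 1))"
    by (simp add: power_divide)
  also have "\<dots> \<le> (1024 * R\<^sup>2) ^ n * (16 * R / \<sigma>) ^ (2 * p * n) * (X ^ (4 * n) * r ^ (n - 1))"
  proof (intro mult_right_mono mult_mono)
    show "1024 * R\<^sup>2 \<le> (1024 * R\<^sup>2) ^ n" using R2 n2 self_le_power[of "1024 * R\<^sup>2" n] by simp
    have "p * 1 \<le> p * n" using n2 by (intro mult_le_mono2) simp
    then have "m + p \<le> 2 * p * n" by (simp add: m_def)
    then show "(16 * R / \<sigma>) ^ (m + p) \<le> (16 * R / \<sigma>) ^ (2 * p * n)"
      using s1 by (intro power_increasing) auto
  qed (use X1 r_pos s1 R2 in auto)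
  also have "\<dots> = (K * real n ^ 4) ^ n * r ^ (n - 1)"
  proof -
    have "X ^ (4 * n) = ((200 * B * L) ^ 4 * real n ^ 4) ^ n"
      unfolding X_def power_mult by (simp only: power_mult_distrib)
    moreover have "(16 * R / \<sigma>) ^ (2 * p * n) = ((16 * R / \<sigma>) ^ (2 * p)) ^ n" by (rule power_mult)
    ultimately show ?thesis unfolding K_def by (simp only: power_mult_distrib mult.assoc)
  qed
  finally have "1 \<le> (K * real n ^ 4) ^ n * r ^ (n - 1)" .
  \<comment> \<open>Squaring makes the exponent of \<open>r\<close> equal to
    \<open>2 * (n - 1)\<close>, which is at least \<open>n\<close> because
    \<open>n \<ge> 2\<close>.\<close>
  then have "1\<^sup>2 \<le> ((K * real n ^ 4) ^ n * r ^ (n - 1))\<^sup>2" by (intro power_mono) auto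
  also have "\<dots> = ((K * real n ^ 4)\<^sup>2) ^ n * r ^ (2 * (n - 1))"
    by (simp add: power_mult_distrib mult_ac flip: power_mult)
  also have "\<dots> \<le> ((K * real n ^ 4)\<^sup>2) ^ n * r ^ n"
    using n2 r_le_1 r_pos by (intro mult_left_mono power_decreasing) auto
  also have "\<dots> = (K\<^sup>2 * real n ^ 8 * r) ^ n"
    by (simp add: power_mult_distrib flip: power_mult)
  finally have "1 \<le> (K\<^sup>2 * real n ^ 8 * r) ^ n" by simp
  moreover have "0 \<le> K\<^sup>2 * real n ^ 8 * r" using r_pos by simp
  ultimately have "1 \<le> K\<^sup>2 * real n ^ 8 * r"
    using power_strict_mono[of "K\<^sup>2 * real n ^ 8 * r" 1 n] n2 by (force simp: not_le[symmetric])
  then show ?thesis by (simp only: K_def)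
qed

end

section \<open>The theorem\<close>

text \<open>\<open>B\<close> is a Lipschitz constant of \<open>D p\<close> on the disc of radius
  \<open>R\<close>; the quadratic estimate for \<open>f ^^ p\<close> follows by the mean value
  inequality. \<open>L\<close> is the sum of Lipschitz constants of the iterates up to
  \<open>p\<close>, so it dominates each of them.\<close>

lemma quadratic_cycle_constants:
  fixes c z0 :: complex
  defines "f \<equiv> \<lambda>z. z\<^sup>2 + c"
  assumes mp: "minimal_period f p z0" and unit: "norm (deriv (f ^^ p) z0) = 1"
  obtains B L \<sigma> R where "quadratic_cycle f c z0 (deriv (f ^^ p) z0) p B L \<sigma> R"
proof -
  define a where "a = (\<lambda>i. (f ^^ i) z0)"
  define D where "D = (\<lambda>k w. \<Prod>i<k. 2 * (f ^^ i) w)"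
  define lam where "lam = deriv (f ^^ p) z0"
  have dD: "((f ^^ k) has_field_derivative D k x) (at x)" for k x
    unfolding D_def f_def by (rule quadratic_iter_deriv)
  have p: "p > 0" "(f ^^ p) z0 = z0" using mp by (auto simp: minimal_period_def)
  have lamD: "D p z0 = lam" unfolding lam_def using dD[THEN DERIV_imp_deriv] by simp
  have amod: "a i = a (i mod p)" for i using funpow_mod_eq[OF p(2), symmetric] by (simp add: a_def)
  have aper: "(f ^^ p) (a i) = a i" for i
    unfolding a_def by (metis p(2) comp_apply funpow_add add.commute)
  have a_inj: "a i \<noteq> a j" if "i < p" "j < p" "i \<noteq> j" for i j
    using inj_onD[OF minimal_period_inj[OF mp]] that by (auto simp: a_def)
  have hol: "(f ^^ k) holomorphic_on UNIV" for k
    using dD by (auto simp: holomorphic_on_def field_differentiable_def)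
  have a_nz: "a i \<noteq> 0" for i
  proof
    assume "a i = 0"
    then have "(f ^^ (i mod p)) z0 = 0" using amod by (simp add: a_def)
    then have "D p z0 = 0" unfolding D_def using p(1) by (intro prod_zero bexI[of _ "i mod p"]) auto
    then show False using lamD unit by (simp add: lam_def)
  qed
  \<comment> \<open>The multiplier is the same along the cycle: both orders of the chain rule for
    \<open>p + i\<close> steps agree, and \<open>D i z0\<close> can be cancelled because the cycle
    avoids the critical point.\<close>
  have Da: "D p (a i) = lam" for i
  proof -
    have Dadd: "D (j + k) x = D j ((f ^^ k) x) * D k x" for j k x
      by (induction j) (auto simp: D_def funpow_add mult_ac)
    have "D p (a i) * D i z0 = D (p + i) z0" using Dadd[of p i z0] by (simp add: a_def)
    also have "p + i = i + p" by simp
    also have "D (i + p) z0 = lam * D i z0" using Dadd[of i p z0] p(2) lamD by simp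
    finally have "D p (a i) * D i z0 = lam * D i z0" .
    moreover have "D i z0 \<noteq> 0" using a_nz by (simp add: D_def a_def)
    ultimately show ?thesis by simp
  qed
  \<comment> \<open>Inserting 1 keeps the set nonempty for \<open>p = 1\<close> and caps
    \<open>\<sigma>\<close>.\<close>
  define S where "S = insert 1 ((\<lambda>(i, j). norm (a i - a j)) ` {(i, j). i < p \<and> j < p \<and> i \<noteq> j})"
  define \<sigma> where "\<sigma> = Min S / 4"
  have finS: "finite S"
  proof -
    have "{(i, j). i < p \<and> j < p \<and> i \<noteq> j} \<subseteq> {..<p} \<times> {..<p}" by auto
    then show ?thesis unfolding S_def using finite_subset by blast
  qed
  have \<sigma>: "0 < \<sigma>" "\<sigma> \<le> 1"
  proof -
    have "Min S \<in> S" using finS by (intro Min_in) (auto simp: S_def)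
    moreover have "x > 0" if "x \<in> S" for x using that a_inj by (auto simp: S_def)
    ultimately show "0 < \<sigma>" by (simp add: \<sigma>_def)
    show "\<sigma> \<le> 1" using Min_le[OF finS, of 1] by (simp add: \<sigma>_def S_def)
  qed
  define R where "R = norm c + 4 + (\<Sum>i<p. norm (a i))"
  have aR: "norm (a i) \<le> R - 4" for i
  proof -
    have "norm (a (i mod p)) \<le> (\<Sum>i<p. norm (a i))"
      using p(1) by (intro member_le_sum) auto
    then show ?thesis using amod[of i] by (simp add: R_def add_increasing)
  qed
  have "D p holomorphic_on UNIV"
    unfolding D_def by (intro holomorphic_intros hol)
  then obtain B where B: "B \<ge> 1" "\<And>x y. norm x \<le> R \<Longrightarrow> norm y \<le> R \<Longrightarrow> norm (D p x - D p y) \<le> B * norm (x - y)"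
    using entire_lipschitz[of "D p" R] by blast
  have "\<forall>j. \<exists>l. l \<ge> 1 \<and> (\<forall>x y. norm x \<le> R \<longrightarrow> norm y \<le> R \<longrightarrow> norm ((f ^^ j) x - (f ^^ j) y) \<le> l * norm (x - y))"
    using entire_lipschitz[OF hol, of R] by metis
  then obtain l where l: "\<And>j. l j \<ge> 1"
    "\<And>j x y. norm x \<le> R \<Longrightarrow> norm y \<le> R \<Longrightarrow> norm ((f ^^ j) x - (f ^^ j) y) \<le> l j * norm (x - y)"
    by metis
  define L where "L = (\<Sum>j\<le>p. l j)"
  have lL: "l j \<le> L" if "j \<le> p" for j
    unfolding L_def using that l(1) by (intro member_le_sum) (auto intro: order_trans[of 0 1])
  have xR: "norm x \<le> R" if "norm (x - a i) \<le> 1" for x i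
    using that aR[of i] norm_triangle_ineq[of "x - a i" "a i"] by simp
  have aR': "norm (a i) \<le> R" for i using aR[of i] by simp
  have a': "(f ^^ i) z0 = a i" and D': "(\<Prod>i<k. 2 * (f ^^ i) x) = D k x" for i k x
    by (simp_all add: a_def D_def)
  have "quadratic_cycle f c z0 lam p B L \<sigma> R"
  proof (unfold_locales, unfold D', unfold a')
    show "4 * \<sigma> \<le> norm (a i - a j)" if "i mod p \<noteq> j mod p" for i j
    proof -
      have "norm (a (i mod p) - a (j mod p)) \<in> S" using that p(1) by (auto simp: S_def)
      then show ?thesis using Min_le[OF finS] amod[of i] amod[of j] by (simp add: \<sigma>_def)
    qed
    show "L \<ge> 1" using lL[of 0] l(1)[of 0] by simp
    show near: "norm (D p x - lam) \<le> B * norm (x - a i)" if "norm (x - a i) \<le> 1" for x i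
      using B(2)[OF xR[OF that] aR'[of i]] by (simp add: Da)
    show "norm ((f ^^ p) x - a i - lam * (x - a i)) \<le> B * (norm (x - a i))\<^sup>2" if x: "norm (x - a i) \<le> 1" for x i
    proof -
      define u where "u = norm (x - a i)"
      have "norm (((f ^^ p) x - lam * x) - ((f ^^ p) (a i) - lam * a i)) \<le> (B * u) * norm (x - a i)"
      proof (rule field_differentiable_bound[of "cball (a i) u" "\<lambda>x. (f ^^ p) x - lam * x" "\<lambda>x. D p x - lam"])
        show "((\<lambda>x. (f ^^ p) x - lam * x) has_field_derivative D p z - lam) (at z within cball (a i) u)" for z
          by (auto intro!: derivative_eq_intros has_field_derivative_at_within[OF dD])
        fix z assume "z \<in> cball (a i) u"
        then have z: "norm (z - a i) \<le> u" by (simp add: dist_norm norm_minus_commute)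
        then have "norm (D p z - lam) \<le> B * norm (z - a i)" using near x by (simp add: u_def)
        also have "\<dots> \<le> B * u" using z B by (intro mult_left_mono) auto
        finally show "norm (D p z - lam) \<le> B * u" .
      qed (auto simp: u_def dist_norm norm_minus_commute)
      then show ?thesis by (simp add: aper u_def power2_eq_square algebra_simps)
    qed
    show "norm ((f ^^ j) x - a (i + j)) \<le> L * norm (x - a i)" if "norm (x - a i) \<le> 1" "j \<le> p" for x i j
    proof -
      have "a (i + j) = (f ^^ j) (a i)" by (simp add: a_def add.commute[of i] funpow_add)
      then have "norm ((f ^^ j) x - a (i + j)) \<le> l j * norm (x - a i)"
        using l(2)[OF xR[OF that(1)] aR'[of i]] by simp
      also have "\<dots> \<le> L * norm (x - a i)" using lL[OF that(2)] by (intro mult_right_mono) auto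
      finally show ?thesis .
    qed
    show "norm c + 4 \<le> R" by (simp add: R_def sum_nonneg)
  qed (use p \<sigma> unit lamD B aR in \<open>auto simp: f_def lam_def a'[symmetric]\<close>)
  then show ?thesis using that unfolding lam_def by blast
qed

section \<open>Small orbits follow the cycle\<close>

lemma orbit_eq_range:
  assumes "(f ^^ m) x = x" "m > 0"
  shows "{(f ^^ k) x | k. k < m} = range (\<lambda>k. (f ^^ k) x)"
proof -
  have "(f ^^ k) x \<in> {(f ^^ k) x | k. k < m}" for k
    using funpow_mod_eq[OF assms(1), symmetric, of k] assms(2) by (metis (mono_tags, lifting) mem_Collect_eq mod_less_divisor)
  then show ?thesis by auto
qed

lemma orbit_shift:
  assumes "(f ^^ m) x = x" "m > 0"
  shows "range (\<lambda>k. (f ^^ k) ((f ^^ l) x)) = range (\<lambda>k. (f ^^ k) x)"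
proof (intro equalityI subsetI)
  fix z assume "z \<in> range (\<lambda>k. (f ^^ k) x)"
  then obtain k where z: "z = (f ^^ k) x" by auto
  have "l \<le> m * l" using assms(2) by simp
  then have "(f ^^ (k + (m * l - l))) ((f ^^ l) x) = (f ^^ k) ((f ^^ (m * l)) x)"
    by (metis add.assoc comp_apply funpow_add le_add_diff_inverse2)
  also have "\<dots> = z" using funpow_fixed_mult[OF assms(1), of l] z by simp
  finally show "z \<in> range (\<lambda>k. (f ^^ k) ((f ^^ l) x))" by blast
next
  fix z assume "z \<in> range (\<lambda>k. (f ^^ k) ((f ^^ l) x))"
  then obtain k where "z = (f ^^ (k + l)) x" by (auto simp: funpow_add)
  then show "z \<in> range (\<lambda>k. (f ^^ k) x)" by blast
qed

lemma minimal_period_shift: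
  assumes "minimal_period f m x"
  shows "minimal_period f m ((f ^^ l) x)"
proof -
  have "(f ^^ m) ((f ^^ l) x) = (f ^^ l) ((f ^^ m) x)" by (metis comp_apply funpow_add add.commute)
  then show ?thesis
    using assms funpow_period_shift[of m f x _ l] unfolding minimal_period_def by metis
qed

context quadratic_cycle begin

text \<open>\<open>f\<close> sends the \<open>r\<close>-disc at \<open>a i\<close> into the disc of
  radius \<open>L * r\<close> at the next cycle point, which meets no \<open>r\<close>-disc around
  another one. So the orbit visits the discs in cyclic order.\<close>

lemma shadowing_point:
  assumes mp: "minimal_period f m x" and r: "r \<le> 1" "(L + 1) * r < 4 * \<sigma>"
    and sub: "{(f ^^ k) x | k. k < m} \<subseteq> (\<Union>i<p. ball (a i) r)"
  obtains w where "minimal_period f m w" "{(f ^^ k) x | k. k < m} = {(f ^^ k) w | k. k < m}"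
    "\<And>k. norm ((f ^^ k) w - a k) < r"
proof -
  have per: "(f ^^ m) x = x" "m > 0" using mp by (auto simp: minimal_period_def)
  note range = orbit_eq_range[OF per]
  have in_ball: "\<exists>i<p. norm ((f ^^ k) x - a i) < r" for k
    using sub unfolding range by (force simp: dist_norm norm_minus_commute)
  obtain i where i: "i < p" "norm (x - a i) < r" using in_ball[of 0] by auto
  have step: "norm ((f ^^ k) x - a (i + k)) < r" for k
  proof (induction k)
    case 0 then show ?case using i by simp
  next
    case (Suc k)
    define z where "z = (f ^^ k) x"
    obtain j where j: "j < p" "norm (f z - a j) < r" using in_ball[of "Suc k"] by (auto simp: z_def)
    have "norm ((f ^^ 1) z - a (i + k + 1)) \<le> L * norm (z - a (i + k))"
      using lipschitz[of z "i + k" 1] Suc r p_pos by (simp add: z_def)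
    also have "\<dots> \<le> L * r" using Suc L by (intro mult_left_mono) (auto simp: z_def)
    finally have fz: "norm (f z - a (Suc (i + k))) \<le> L * r" by simp
    have "Suc (i + k) mod p = j mod p"
    proof (rule ccontr)
      assume "Suc (i + k) mod p \<noteq> j mod p"
      from sep[OF this] have "4 * \<sigma> \<le> norm ((f z - a j) - (f z - a (Suc (i + k))))" by simp
      also have "\<dots> \<le> norm (f z - a j) + norm (f z - a (Suc (i + k)))" by (rule norm_triangle_ineq4)
      finally show False using j(2) fz r(2) by (simp add: algebra_simps)
    qed
    then have "a (Suc (i + k)) = a j" by (rule a_cong)
    then show ?case using j by (simp add: z_def)
  qed
  \<comment> \<open>Moves the starting point into the disc around \<open>z0\<close>, so that the
    phases agree.\<close>
  define w where "w = (f ^^ (p - i)) x"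
  show thesis
  proof
    show mw: "minimal_period f m w" unfolding w_def by (rule minimal_period_shift[OF mp])
    then show "{(f ^^ k) x | k. k < m} = {(f ^^ k) w | k. k < m}"
      using orbit_shift[where l = "p - i", OF per] orbit_eq_range[where f = f and m = m and x = w]
      unfolding range w_def by (simp add: minimal_period_def)
    show "norm ((f ^^ k) w - a k) < r" for k
    proof -
      have "a (i + (k + (p - i))) = a k" using i(1) by (intro a_cong) auto
      then show ?thesis using step[of "k + (p - i)"] by (simp add: w_def funpow_add)
    qed
  qed
qed

text \<open>Distinct periodic orbits are disjoint, so for \<open>n \<ge> 2\<close> two of them would
  contradict \<open>small_cycles_bound\<close>. For \<open>n = 1\<close> the points considered are
  fixed by \<open>f ^^ p\<close>.\<close>

lemma unique_small_cycle:
  fixes n :: nat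
  assumes lam1: "lam \<noteq> 1" and n: "n \<ge> 1" and r: "r > 0" "r \<le> 1" "(L + 1) * r < 4 * \<sigma>" "B * r < norm (lam - 1)"
    and small: "64 * B * L * (real n)\<^sup>2 * r \<le> \<sigma>"
    and smaller: "(1024 * R\<^sup>2 * (16 * R / \<sigma>) ^ (2 * p) * (200 * B * L) ^ 4)\<^sup>2 * real n ^ 8 * r < 1"
    and o1: "o1 \<in> periodic_orbits f (n * p)" "o1 \<subseteq> (\<Union>i<p. ball (a i) r)"
    and o2: "o2 \<in> periodic_orbits f (n * p)" "o2 \<subseteq> (\<Union>i<p. ball (a i) r)"
  shows "o1 = o2"
proof (rule ccontr)
  assume ne: "o1 \<noteq> o2"
  obtain w where w: "minimal_period f (n * p) w" "o1 = {(f ^^ k) w | k. k < n * p}" "\<And>k. norm ((f ^^ k) w - a k) < r"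
  proof -
    obtain x where x: "minimal_period f (n * p) x" "o1 = {(f ^^ k) x | k. k < n * p}"
      using o1(1) unfolding periodic_orbits_def by auto
    obtain v where v: "minimal_period f (n * p) v" "{(f ^^ k) x | k. k < n * p} = {(f ^^ k) v | k. k < n * p}"
      "\<And>k. norm ((f ^^ k) v - a k) < r"
      using shadowing_point[OF x(1) r(2,3) o1(2)[unfolded x(2)]] by blast
    show thesis by (rule that[OF v(1) _ v(3)]) (simp only: x(2) v(2))
  qed
  obtain w' where w': "minimal_period f (n * p) w'" "o2 = {(f ^^ k) w' | k. k < n * p}" "\<And>k. norm ((f ^^ k) w' - a k) < r"
  proof -
    obtain x where x: "minimal_period f (n * p) x" "o2 = {(f ^^ k) x | k. k < n * p}"
      using o2(1) unfolding periodic_orbits_def by auto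
    obtain v where v: "minimal_period f (n * p) v" "{(f ^^ k) x | k. k < n * p} = {(f ^^ k) v | k. k < n * p}"
      "\<And>k. norm ((f ^^ k) v - a k) < r"
      using shadowing_point[OF x(1) r(2,3) o2(2)[unfolded x(2)]] by blast
    show thesis by (rule that[OF v(1) _ v(3)]) (simp only: x(2) v(2))
  qed
  show False
  proof (cases "n = 1")
    case True
    \<comment> \<open>As \<open>lam \<noteq> 1\<close>, the linear term outweighs the quadratic one,
      so \<open>a 0\<close> is an isolated fixed point of \<open>f ^^ p\<close>.\<close>
    have fixed: "x = a 0" if "(f ^^ p) x = x" "norm (x - a 0) < r" for x
    proof (rule ccontr)
      assume "x \<noteq> a 0"
      then have pos: "norm (x - a 0) > 0" by simp
      have "(f ^^ p) x - a 0 - lam * (x - a 0) = - ((lam - 1) * (x - a 0))"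
        unfolding that(1) by (simp add: algebra_simps)
      then have "norm (lam - 1) * norm (x - a 0) \<le> B * (norm (x - a 0))\<^sup>2"
        using iterate_near[of x 0] that(2) r(2) by (simp add: norm_mult)
      then have "norm (lam - 1) \<le> B * norm (x - a 0)" using pos by (simp add: power2_eq_square)
      also have "\<dots> \<le> B * r" using that(2) B by (intro mult_left_mono) auto
      finally show False using r(4) by simp
    qed
    have "w = a 0" "w' = a 0"
      using fixed[of w] fixed[of w'] w(1) w(3)[of 0] w'(1) w'(3)[of 0] True by (auto simp: minimal_period_def)
    then show False using ne w(2) w'(2) by simp
  next
    case False
    have "(f ^^ j) w \<noteq> (f ^^ k) w'" for j k
    proof
      assume e: "(f ^^ j) w = (f ^^ k) w'"
      have pw: "(f ^^ (n * p)) w = w" "n * p > 0" and pw': "(f ^^ (n * p)) w' = w'" "n * p > 0"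
        using w(1) w'(1) by (auto simp: minimal_period_def)
      have "o1 = range (\<lambda>l. (f ^^ l) ((f ^^ j) w))" "o2 = range (\<lambda>l. (f ^^ l) ((f ^^ k) w'))"
        unfolding orbit_shift[OF pw] orbit_shift[OF pw'] w(2) w'(2) by (rule orbit_eq_range[OF pw] orbit_eq_range[OF pw'])+
      then show False using ne e by simp
    qed
    then interpret small_cycles f c z0 lam p B L \<sigma> R a D n r w w'
      using False n r(1) small w(1,3) w'(1,3)
      by unfold_locales (auto simp: mult.commute a_def)
    show False using small_cycles_bound smaller by linarith
  qed
qed

end

theorem theorem3:
  fixes c z0 :: complex and p :: nat
  defines "f \<equiv> (\<lambda>z. z ^ 2 + c)"
  assumes "cremer_point f p z0"
  shows "\<forall>\<delta>::real. \<delta> > 0 \<longrightarrow> (\<exists>r0::real. r0 > 0 \<and>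
           (\<forall>n::nat. n \<ge> 1 \<longrightarrow>
              (let rn = r0 * exp (- real n * \<delta>);
                   Orbs = {orb \<in> periodic_orbits f (n * p). orb \<subseteq> (\<Union>i<p. ball ((f ^^ i) z0) rn)}
               in finite Orbs \<and> card Orbs \<le> p)))"
proof (intro allI impI)
  fix \<delta> :: real assume \<delta>: "\<delta> > 0"
  define lam where "lam = deriv (f ^^ p) z0"
  have mp: "minimal_period f p z0" using assms(2) by (simp add: cremer_point_def)
  obtain \<alpha> :: real where \<alpha>: "\<alpha> \<notin> \<rat>" "lam = exp (2 * of_real pi * \<i> * of_real \<alpha>)"
    using assms(2) by (auto simp: cremer_point_def lam_def)
  have lam: "norm lam = 1" using \<alpha>(2) by simp
  have lam1: "lam \<noteq> 1"
  proof
    assume "lam = 1"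
    then obtain k :: int where "2 * pi * \<alpha> = of_int (2 * k) * pi"
      using \<alpha>(2) by (auto simp: exp_eq_1)
    then have "\<alpha> = of_int k" by simp
    then show False using \<alpha>(1) by auto
  qed
  obtain B L \<sigma> R where "quadratic_cycle f c z0 lam p B L \<sigma> R"
    using quadratic_cycle_constants[of c p z0] mp lam unfolding lam_def f_def by blast
  then interpret quadratic_cycle f c z0 lam p B L \<sigma> R "\<lambda>i. (f ^^ i) z0" "\<lambda>k w. \<Prod>i<k. 2 * (f ^^ i) w" .
  define K where "K = (1024 * R\<^sup>2 * (16 * R / \<sigma>) ^ (2 * p) * (200 * B * L) ^ 4)\<^sup>2"
  \<comment> \<open>\<open>M\<close> dominates the coefficients of all smallness conditions in
    \<open>unique_small_cycle\<close>, and \<open>C\<close> below bounds the polynomial factor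
    against the exponential; \<open>r0\<close> is chosen so that
    \<open>n ^ 8 * r * M \<le> 1 / 2\<close> for every \<open>n\<close>.\<close>
  define M where "M = 1 + (L + 1) / \<sigma> + B / norm (lam - 1) + 64 * B * L / \<sigma> + K"
  have "(\<lambda>n. real n ^ 8 * exp (- real n * \<delta>)) \<longlonglongrightarrow> 0" using \<delta> by real_asymp
  then have "Bseq (\<lambda>n. real n ^ 8 * exp (- real n * \<delta>))" by (intro convergent_imp_Bseq convergentI)
  then obtain C where C: "C > 0" "\<And>n. real n ^ 8 * exp (- real n * \<delta>) \<le> C"
    unfolding Bseq_def by fastforce
  have terms: "(L + 1) / \<sigma> > 0" "B / norm (lam - 1) > 0" "64 * B * L / \<sigma> > 0" "K \<ge> 0"
    using B L sigma lam1 by (auto simp: K_def)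
  then have M1: "M \<ge> 1" and M_ge: "(L + 1) / \<sigma> \<le> M" "B / norm (lam - 1) \<le> M" "64 * B * L / \<sigma> \<le> M" "K \<le> M"
    unfolding M_def by linarith+
  define r0 where "r0 = 1 / (2 * C * M)"
  have r0: "r0 > 0" using C(1) M1 by (simp add: r0_def)
  have unique: "o1 = o2"
    if n: "n \<ge> 1"
      and o1: "o1 \<in> periodic_orbits f (n * p)" "o1 \<subseteq> (\<Union>i<p. ball ((f ^^ i) z0) (r0 * exp (- real n * \<delta>)))"
      and o2: "o2 \<in> periodic_orbits f (n * p)" "o2 \<subseteq> (\<Union>i<p. ball ((f ^^ i) z0) (r0 * exp (- real n * \<delta>)))"
    for n :: nat and o1 o2
  proof -
    define r where "r = r0 * exp (- real n * \<delta>)"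
    have r: "r > 0" using r0 by (simp add: r_def)
    have n8: "real n ^ 8 * r * M \<le> 1 / 2"
    proof -
      have "real n ^ 8 * exp (- real n * \<delta>) * (r0 * M) \<le> C * (r0 * M)"
        using C(2)[of n] r0 M1 by (intro mult_right_mono) auto
      also have "\<dots> = 1 / 2" using C(1) M1 by (simp add: r0_def)
      finally show ?thesis by (simp add: r_def mult_ac)
    qed
    \<comment> \<open>All conditions on \<open>r\<close> have this shape, with exponent
      \<open>k\<close> equal to 0, 2 or 8.\<close>
    have pw: "real n ^ k * x * r < 1" if "k \<le> 8" "0 \<le> x" "x \<le> M" for k x
    proof -
      have "real n ^ k * x * r \<le> real n ^ 8 * M * r"
        using that n r by (intro mult_right_mono mult_mono power_increasing) auto
      then show ?thesis using n8 by (simp add: mult_ac)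
    qed
    show "o1 = o2"
    proof (rule unique_small_cycle[OF lam1 n r])
      show "r \<le> 1" using pw[of 0 1] M1 by simp
      show "(L + 1) * r < 4 * \<sigma>"
        using pw[of 0 "(L + 1) / \<sigma>"] terms(1) M_ge(1) sigma by (simp add: pos_divide_less_eq)
      show "B * r < norm (lam - 1)"
        using pw[of 0 "B / norm (lam - 1)"] terms(2) M_ge(2) lam1 by (simp add: pos_divide_less_eq)
      show "64 * B * L * (real n)\<^sup>2 * r \<le> \<sigma>"
        using pw[of 2 "64 * B * L / \<sigma>"] terms(3) M_ge(3) sigma by (simp add: pos_divide_less_eq mult_ac)
      show "(1024 * R\<^sup>2 * (16 * R / \<sigma>) ^ (2 * p) * (200 * B * L) ^ 4)\<^sup>2 * real n ^ 8 * r < 1"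
        using pw[of 8 K] terms(4) M_ge(4) unfolding K_def[symmetric] by (simp add: mult.commute)
    qed (use o1 o2 in \<open>auto simp: r_def\<close>)
  qed
  show "\<exists>r0>0. \<forall>n\<ge>1. let rn = r0 * exp (- real n * \<delta>);
                   Orbs = {orb \<in> periodic_orbits f (n * p). orb \<subseteq> (\<Union>i<p. ball ((f ^^ i) z0) rn)}
               in finite Orbs \<and> card Orbs \<le> p"
  proof (intro exI[of _ r0] conjI allI impI r0)
    fix n :: nat assume n: "n \<ge> 1"
    define Orbs where "Orbs = {orb \<in> periodic_orbits f (n * p). orb \<subseteq> (\<Union>i<p. ball ((f ^^ i) z0) (r0 * exp (- real n * \<delta>)))}"
    have "\<exists>x. Orbs \<subseteq> {x}"
    proof (cases "Orbs = {}")
      case False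
      then obtain x where x: "x \<in> Orbs" by blast
      have "y = x" if "y \<in> Orbs" for y
        using unique[OF n, of y x] that x by (simp add: Orbs_def)
      then show ?thesis by blast
    qed simp
    then obtain x where "Orbs \<subseteq> {x}" by blast
    \<comment> \<open>At most one orbit remains, and \<open>p \<ge> 1\<close>.\<close>
    then have "finite Orbs" "card Orbs \<le> 1"
      using finite_subset card_mono[of "{x}" Orbs] by auto
    then show "let rn = r0 * exp (- real n * \<delta>);
                   Orbs = {orb \<in> periodic_orbits f (n * p). orb \<subseteq> (\<Union>i<p. ball ((f ^^ i) z0) rn)}
               in finite Orbs \<and> card Orbs \<le> p"
      unfolding Let_def Orbs_def[symmetric] using p_pos by simp
  qed
qed

end
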